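(* Let $n\ge 2$. There is a constant $C$ depending only on $n$ (possibly different in the two inequalities) such that for every $f\in C_c^\infty(\mathbb{R}^n)$ and every $x\in\mathbb{R}^n$, $$M_{L^{n',1}}f(x)\le C\,M_1(|\nabla f|)(x)+Mf(x),$$ and hence $$M_{L^{n',1}}f(x)\le C\,I_1(|\nabla f|)(x).$$
   Context: Here $n'=\frac{n}{n-1}$. The letter $Q$ denotes a cube in $\mathbb{R}^n$ with side length $\ell(Q)$ and Lebesgue measure $|Q|$. $Mf(x)=\sup_{Q\ni x}\frac1{|Q|}\int_Q|f|$ is the Hardy–Littlewood maximal function, $M_1g(x)=\sup_{Q\ni x}\ell(Q)\frac1{|Q|}\int_Q|g|$ is the fractional maximal function of order 1, and $I_1g(x)=\int_{\mathbb{R}^n}\frac{g(y)}{|x-y|^{n-1}}\,dy$ is the Riesz potential of order 1. For a measure space $(X,\mu)$ and $0<p,q<\infty$, $$\|f\|_{L^{p,q}(\mu)}=\left(p\int_0^\infty t^q\,\mu(\{x\in X:|f(x)|>t\})^{q/p}\,\frac{dt}{t}\right)^{1/q}.$$ The normalized Lorentz average over a cube is $\|f\|_{L^{p,q}(Q)}:=\|f\|_{L^{p,q}(Q,\,dx/|Q|)}=|Q|^{-1/p}\|f\mathbf 1_Q\|_{L^{p,q}(\mathbb{R}^n)}$, and the Lorentz maximal function is $M_{L^{p,q}}f(x)=\sup_{Q\ni x}\|f\|_{L^{p,q}(Q)}$.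
   Formalization: In the first inequality Mf(x) is replaced by n'Mf(x): with the stated normalization the constant 1 has norm n' in L^{n',1}(Q), and the printed coefficient 1 fails for every n≥2, e.g. for sums of dyadically dilated bump functions. *)

theory Defs
  imports "HOL-Analysis.Analysis"
begin

primrec C_k :: "nat \<Rightarrow> (real^'n \<Rightarrow> real) \<Rightarrow> bool" where
  "C_k 0 f \<longleftrightarrow> continuous_on UNIV f"
| "C_k (Suc k) f \<longleftrightarrow>
     (\<forall>x. f differentiable (at x)) \<and>
     (\<forall>i. C_k k (\<lambda>x. frechet_derivative f (at x) (axis i 1)))"

definition Cc_infinity :: "(real^'n \<Rightarrow> real) set" where
  "Cc_infinity = {f. (\<forall>k. C_k k f) \<and> compact (closure {x. f x \<noteq> 0})}"

definition gradient :: "(real^'n \<Rightarrow> real) \<Rightarrow> real^'n \<Rightarrow> real^'n" where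
  "gradient f x = (THE D. GDERIV f x :> D)"

(* Cubes are closed, with sides parallel to the axes: a is the lower corner, l the side length. *)
definition cube :: "real^'n \<Rightarrow> real \<Rightarrow> (real^'n) set" where
  "cube a l = cbox a (\<chi> i. a $ i + l)"

definition cubes_at :: "real^'n \<Rightarrow> ((real^'n) \<times> real) set" where
  "cubes_at x = {(a, l). 0 < l \<and> x \<in> cube a l}"

(* All norms, averages and suprema take values in ennreal, so no finiteness is presupposed. *)
definition cube_average :: "(real^'n \<Rightarrow> real) \<Rightarrow> (real^'n) set \<Rightarrow> ennreal" where
  "cube_average f Q = (\<integral>\<^sup>+y\<in>Q. ennreal \<bar>f y\<bar> \<partial>lborel) / emeasure lborel Q"

definition HL_maximal :: "(real^'n \<Rightarrow> real) \<Rightarrow> real^'n \<Rightarrow> ennreal" where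
  "HL_maximal f x = (SUP (a, l) \<in> cubes_at x. cube_average f (cube a l))"

definition fractional_maximal_1 :: "(real^'n \<Rightarrow> real) \<Rightarrow> real^'n \<Rightarrow> ennreal" where
  "fractional_maximal_1 g x = (SUP (a, l) \<in> cubes_at x. ennreal l * cube_average g (cube a l))"

(* Nonnegative densities only, whence the type of g. The integrand may be infinite at y = x,
   which is a null set. *)
definition riesz_potential_1 :: "(real^'n \<Rightarrow> ennreal) \<Rightarrow> real^'n \<Rightarrow> ennreal" where
  "riesz_potential_1 g x = (\<integral>\<^sup>+y. g y / ennreal (norm (x - y) ^ (CARD('n) - 1)) \<partial>lborel)"

(* Used only for exponents a > 0, for which infinity to the power a is infinity. *)
definition ennreal_powr :: "ennreal \<Rightarrow> real \<Rightarrow> ennreal" where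
  "ennreal_powr u a = (if u = \<infinity> then \<infinity> else ennreal (enn2real u powr a))"

(* With this normalization the indicator of E has quasinorm (p/q) powr (1/q) * measure M E powr (1/p);
   in particular the constant 1 on a probability space has L^{p,1} norm p, not 1. *)
definition lorentz_norm :: "real \<Rightarrow> real \<Rightarrow> 'a measure \<Rightarrow> ('a \<Rightarrow> real) \<Rightarrow> ennreal" where
  "lorentz_norm p q M f =
     ennreal_powr
       (ennreal p *
        (\<integral>\<^sup>+t\<in>{0<..}. ennreal (t powr q) *
            ennreal_powr (emeasure M {x \<in> space M. \<bar>f x\<bar> > t}) (q / p) / ennreal t \<partial>lborel))
       (1 / q)"

(* uniform_measure lborel Q is the measure dx/|Q| concentrated on Q. *)
definition lorentz_maximal :: "real \<Rightarrow> real \<Rightarrow> (real^'n \<Rightarrow> real) \<Rightarrow> real^'n \<Rightarrow> ennreal" where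
  "lorentz_maximal p q f x =
     (SUP (a, l) \<in> cubes_at x. lorentz_norm p q (uniform_measure lborel (cube a l)) f)"

definition dual_exponent :: "nat \<Rightarrow> real" where
  "dual_exponent n = real n / (real n - 1)"

end

theory Submission
  imports Defs
begin

text \<open>
  Fix a cube \<open>Q\<close> of side length \<open>l\<close> and let \<open>u\<close> be the relative volume in \<open>Q\<close> of
  \<open>{\<bar>f\<bar> > t}\<close>, a function of \<open>t\<close>. For \<open>p = n / (n - 1)\<close> the Lorentz norm over \<open>Q\<close> is \<open>p\<close>
  times the integral over \<open>t > 0\<close> of \<open>u\<close> to the power \<open>1 - 1 / n\<close>. This power is at most
  \<open>u + min u (1 - u) powr (1 - 1 / n)\<close>. The integral of \<open>u\<close> is the average of \<open>\<bar>f\<bar>\<close>, which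
  accounts for the Hardy-Littlewood maximal function with the factor \<open>p\<close>. The remaining term
  would be handled classically by the relative isoperimetric inequality in \<open>Q\<close> at each level and the
  coarea formula; it is at most a constant times \<open>l\<close> times the average of the gradient.

  Both tools are replaced by one elementary computation, \<open>nn_integral_segments_le\<close>. Connect all
  points of a set \<open>A\<close> with all points of a set \<open>B\<close> by segments. If \<open>\<bar>f\<bar>\<close> is at least \<open>t + h\<close>
  on one set and at most \<open>t\<close> on the other, each segment crosses the layer \<open>{t < \<bar>f\<bar> < t + h}\<close>,
  and the line integral of the length of the gradient over the part of the segment in the layer is
  at least \<open>h\<close>. Integrating over all pairs of points and changing variables for each fixed
  parameter on the segments bounds \<open>h\<close> times the product of the volumes of the two sets by a
  multiple of the integral of the gradient over the layer (\<open>layer_isoperimetric\<close>). After division by \<open>h\<close>,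
  the right-hand side integrated over all levels \<open>t\<close> is a constant times the integral of the
  gradient over \<open>Q\<close>, for every \<open>h\<close>, and Fatou's lemma permits \<open>h\<close> to tend to \<open>0\<close>
  (\<open>nn_integral_min_level_sets_le\<close>).

  For the second inequality the fractional maximal function is compared with the Riesz potential
  by comparing kernels. The Hardy-Littlewood maximal function is treated by the same segment
  computation, now between \<open>Q\<close> and cubes containing \<open>x\<close> whose size tends to infinity, over which the
  average of \<open>\<bar>f\<bar>\<close> vanishes in the limit (\<open>cube_average_le_riesz_add\<close>,
  \<open>HL_maximal_le_riesz\<close>).
\<close>

section \<open>Crossing a layer of values in one variable\<close>

lemma abs_diff_le_nn_integral_abs_deriv:
  fixes \<phi> \<phi>' :: "real \<Rightarrow> real"
  assumes "a \<le> b"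
    and der: "\<And>s. s \<in> {a..b} \<Longrightarrow> (\<phi> has_real_derivative \<phi>' s) (at s)"
    and cont: "continuous_on {a..b} \<phi>'"
  shows "ennreal \<bar>\<phi> b - \<phi> a\<bar> \<le> (\<integral>\<^sup>+s\<in>{a<..<b}. ennreal \<bar>\<phi>' s\<bar> \<partial>lborel)"
proof -
  have "(\<phi>' has_integral \<phi> b - \<phi> a) {a..b}"
    using \<open>a \<le> b\<close> has_field_derivative_at_within[OF der]
    by (intro fundamental_theorem_of_calculus)
       (simp_all flip: has_real_derivative_iff_has_vector_derivative)
  moreover have abs: "((\<lambda>s. \<bar>\<phi>' s\<bar>) has_integral integral {a..b} (\<lambda>s. \<bar>\<phi>' s\<bar>)) {a..b}"
    using cont by (intro integrable_integral integrable_continuous_interval continuous_intros)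
  ultimately have "\<bar>\<phi> b - \<phi> a\<bar> \<le> integral {a..b} (\<lambda>s. \<bar>\<phi>' s\<bar>)"
    using integral_norm_bound_integral[of \<phi>' "{a..b}" "\<lambda>s. \<bar>\<phi>' s\<bar>"]
    by (auto simp: has_integral_iff)
  also have "ennreal (integral {a..b} (\<lambda>s. \<bar>\<phi>' s\<bar>)) = (\<integral>\<^sup>+s\<in>{a<..<b}. ennreal \<bar>\<phi>' s\<bar> \<partial>lborel)"
    using abs nn_integral_has_integral_lebesgue[of "{a<..<b}" "\<lambda>s. \<bar>\<phi>' s\<bar>"]
    by (simp add: has_integral_Icc_iff_Ioo ennreal_indicator ennreal_mult'' mult.commute)
  finally show ?thesis by (simp add: ennreal_leI)
qed

text \<open>
  The last time before \<open>b\<close> at which \<open>\<psi>\<close> is still high, where \<open>b\<close> is the first time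
  at which it is low: in between, the values lie strictly inside the layer.
\<close>

lemma exists_crossing_interval:
  fixes \<psi> :: "real \<Rightarrow> real"
  assumes cont: "continuous_on {0..1} \<psi>" and "c < d" "d \<le> \<psi> 0" "\<psi> 1 \<le> c"
  obtains a b where "0 \<le> a" "a \<le> b" "b \<le> 1" "d \<le> \<psi> a" "\<psi> b \<le> c" "\<And>s. a < s \<Longrightarrow> s < b \<Longrightarrow> c < \<psi> s \<and> \<psi> s < d"
proof -
  define S where "S = {s \<in> {0..1}. \<psi> s \<le> c}"
  have "closed S" unfolding S_def
    by (rule continuous_on_closed_Collect_le[OF cont continuous_on_const]; simp)
  moreover have "bounded S"
    by (rule bounded_subset[of "{0..1::real}"]) (auto simp: S_def)
  ultimately have S: "compact S" "S \<noteq> {}" using assms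
    by (auto simp: S_def compact_eq_bounded_closed)
  obtain b where b: "b \<in> S" "\<And>s. s \<in> S \<Longrightarrow> b \<le> s"
    using compact_attains_inf[OF S] by blast
  define T where "T = {s \<in> {0..b}. d \<le> \<psi> s}"
  have contb: "continuous_on {0..b} \<psi>" using b by (intro continuous_on_subset[OF cont]) (auto simp: S_def)
  have "closed T" unfolding T_def
    by (rule continuous_on_closed_Collect_le[OF continuous_on_const contb]; simp)
  moreover have "bounded T"
    by (rule bounded_subset[of "{0..b}"]) (auto simp: T_def)
  ultimately have T: "compact T" "T \<noteq> {}" using assms b
    by (auto simp: T_def S_def compact_eq_bounded_closed)
  obtain a where a: "a \<in> T" "\<And>s. s \<in> T \<Longrightarrow> s \<le> a"
    using compact_attains_sup[OF T] by blast
  show thesis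
  proof (rule that[of a b])
    fix s assume "a < s" "s < b"
    then show "c < \<psi> s \<and> \<psi> s < d" using a(2)[of s] b(2)[of s] a(1) b(1)
      by (force simp: S_def T_def)
  qed (use a b in \<open>auto simp: S_def T_def\<close>)
qed

text \<open>
  Crossing a layer of values costs at least its width, and the cost is paid while the value is
  inside the layer. Restricting the integral to the layer is what makes the costs of disjoint
  layers add up, as in the coarea formula. The zeros of \<open>\<phi>\<close>, where \<open>\<bar>\<phi>\<bar>\<close> has
  corners, do no harm because an increment of \<open>\<bar>\<phi>\<bar>\<close> is at most one of \<open>\<phi>\<close>.
\<close>

lemma crossing_le_nn_integral_abs_deriv:
  fixes \<phi> \<phi>' :: "real \<Rightarrow> real"
  assumes der: "\<And>s. s \<in> {0..1} \<Longrightarrow> (\<phi> has_real_derivative \<phi>' s) (at s)"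
    and cont: "continuous_on {0..1} \<phi>'"
    and "c < d"
    and ends: "\<bar>\<phi> 0\<bar> \<le> c \<and> d \<le> \<bar>\<phi> 1\<bar> \<or> \<bar>\<phi> 1\<bar> \<le> c \<and> d \<le> \<bar>\<phi> 0\<bar>"
  shows "ennreal (d - c) \<le>
    (\<integral>\<^sup>+s\<in>{0<..<1}. ennreal \<bar>\<phi>' s\<bar> * indicator {c<..<d} \<bar>\<phi> s\<bar> \<partial>lborel)"
proof -
  have cphi: "continuous_on {0..1} (\<lambda>s. \<bar>\<phi> s\<bar>)"
    by (intro continuous_intros DERIV_continuous_on[of _ _ \<phi>'])
       (simp add: has_field_derivative_at_within[OF der])
  have "\<exists>a b. 0 \<le> a \<and> a \<le> b \<and> b \<le> 1 \<and> d - c \<le> \<bar>\<bar>\<phi> b\<bar> - \<bar>\<phi> a\<bar>\<bar> \<and>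
      (\<forall>s. a < s \<longrightarrow> s < b \<longrightarrow> c < \<bar>\<phi> s\<bar> \<and> \<bar>\<phi> s\<bar> < d)"
    using ends[THEN disj_commute[THEN iffD1]]
  proof
    assume "\<bar>\<phi> 1\<bar> \<le> c \<and> d \<le> \<bar>\<phi> 0\<bar>"
    then obtain a b where "0 \<le> a" "a \<le> b" "b \<le> 1" "d \<le> \<bar>\<phi> a\<bar>" "\<bar>\<phi> b\<bar> \<le> c"
        "\<And>s. a < s \<Longrightarrow> s < b \<Longrightarrow> c < \<bar>\<phi> s\<bar> \<and> \<bar>\<phi> s\<bar> < d"
      using exists_crossing_interval[OF cphi \<open>c < d\<close>] by blast
    then show ?thesis by (intro exI[of _ a] exI[of _ b]) auto
  next
    assume "\<bar>\<phi> 0\<bar> \<le> c \<and> d \<le> \<bar>\<phi> 1\<bar>"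
    then obtain a b where "0 \<le> a" "a \<le> b" "b \<le> 1" "- c \<le> - \<bar>\<phi> a\<bar>" "- \<bar>\<phi> b\<bar> \<le> - d"
        "\<And>s. a < s \<Longrightarrow> s < b \<Longrightarrow> - d < - \<bar>\<phi> s\<bar> \<and> - \<bar>\<phi> s\<bar> < - c"
      using exists_crossing_interval[OF continuous_on_minus[OF cphi], of "-d" "-c"] \<open>c < d\<close>
      by (metis neg_le_iff_le neg_less_iff_less)
    then show ?thesis by (intro exI[of _ a] exI[of _ b]) auto
  qed
  then obtain a b where ab: "0 \<le> a" "a \<le> b" "b \<le> 1" "d - c \<le> \<bar>\<bar>\<phi> b\<bar> - \<bar>\<phi> a\<bar>\<bar>"
      "\<And>s. a < s \<Longrightarrow> s < b \<Longrightarrow> c < \<bar>\<phi> s\<bar> \<and> \<bar>\<phi> s\<bar> < d" by blast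
  have "ennreal (d - c) \<le> ennreal \<bar>\<phi> b - \<phi> a\<bar>" using ab(4) by (intro ennreal_leI) linarith
  also have "\<dots> \<le> (\<integral>\<^sup>+s\<in>{a<..<b}. ennreal \<bar>\<phi>' s\<bar> \<partial>lborel)"
    using ab by (intro abs_diff_le_nn_integral_abs_deriv der continuous_on_subset[OF cont]) auto
  also have "\<dots> \<le> (\<integral>\<^sup>+s\<in>{0<..<1}. ennreal \<bar>\<phi>' s\<bar> * indicator {c<..<d} \<bar>\<phi> s\<bar> \<partial>lborel)"
    using ab by (intro nn_integral_mono) (auto split: split_indicator)
  finally show ?thesis .
qed

section \<open>Averages over all segments between two sets\<close>

lemma nn_integral_affine:
  fixes g :: "'a::euclidean_space \<Rightarrow> ennreal"
  assumes [measurable]: "g \<in> borel_measurable borel" and "c > 0"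
  shows "(\<integral>\<^sup>+w. g (t + c *\<^sub>R w) \<partial>lborel) = ennreal (1 / c ^ DIM('a)) * (\<integral>\<^sup>+z. g z \<partial>lborel)"
proof -
  have "(\<integral>\<^sup>+z. g z \<partial>lborel) = ennreal (c ^ DIM('a)) * (\<integral>\<^sup>+w. g (t + c *\<^sub>R w) \<partial>lborel)"
    using \<open>c > 0\<close>
    by (subst lborel_affine[of c t])
       (auto simp: nn_integral_density nn_integral_distr nn_integral_cmult)
  then show ?thesis using \<open>c > 0\<close>
    by (simp add: mult.assoc[symmetric] ennreal_mult[symmetric])
qed

text \<open>
  For fixed \<open>s\<close> the point at parameter \<open>s\<close> on the segment from \<open>y\<close> to \<open>w\<close> is a dilation of \<open>w\<close>
  by the factor \<open>s\<close> when \<open>y\<close> is frozen, and of \<open>y\<close> by \<open>1 - s\<close> when \<open>w\<close> is frozen. Discarding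
  the constraint on the dilated variable gives the two bounds.
\<close>

lemma nn_integral_segment_point_le:
  fixes g :: "'a::euclidean_space \<Rightarrow> ennreal"
  assumes [measurable]: "g \<in> borel_measurable borel" "A \<in> sets borel" "B \<in> sets borel"
    and s: "0 < s" "s < 1"
  shows "(\<integral>\<^sup>+y\<in>A. (\<integral>\<^sup>+w\<in>B. g (y + s *\<^sub>R (w - y)) \<partial>lborel) \<partial>lborel)
           \<le> ennreal (1 / s ^ DIM('a)) * emeasure lborel A * (\<integral>\<^sup>+z. g z \<partial>lborel)" (is "?I \<le> ?R1")
    and "(\<integral>\<^sup>+y\<in>A. (\<integral>\<^sup>+w\<in>B. g (y + s *\<^sub>R (w - y)) \<partial>lborel) \<partial>lborel)
           \<le> ennreal (1 / (1 - s) ^ DIM('a)) * emeasure lborel B * (\<integral>\<^sup>+z. g z \<partial>lborel)" (is "_ \<le> ?R2")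
proof -
  have 1: "(\<integral>\<^sup>+w\<in>B. g (y + s *\<^sub>R (w - y)) \<partial>lborel) \<le> ennreal (1 / s ^ DIM('a)) * (\<integral>\<^sup>+z. g z \<partial>lborel)" for y
  proof -
    have "(\<integral>\<^sup>+w\<in>B. g (y + s *\<^sub>R (w - y)) \<partial>lborel) \<le> (\<integral>\<^sup>+w. g ((1 - s) *\<^sub>R y + s *\<^sub>R w) \<partial>lborel)"
      by (intro nn_integral_mono) (auto split: split_indicator simp: algebra_simps)
    then show ?thesis using s by (simp add: nn_integral_affine)
  qed
  have "?I \<le> (\<integral>\<^sup>+y\<in>A. (ennreal (1 / s ^ DIM('a)) * (\<integral>\<^sup>+z. g z \<partial>lborel)) \<partial>lborel)"
    by (intro nn_integral_mono mult_right_mono 1) auto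
  also have "\<dots> = ?R1" by (simp add: nn_integral_cmult_indicator, simp add: mult_ac)
  finally show "?I \<le> ?R1" .
  have 2: "(\<integral>\<^sup>+y\<in>A. g (y + s *\<^sub>R (w - y)) \<partial>lborel) \<le> ennreal (1 / (1 - s) ^ DIM('a)) * (\<integral>\<^sup>+z. g z \<partial>lborel)" for w
  proof -
    have "(\<integral>\<^sup>+y\<in>A. g (y + s *\<^sub>R (w - y)) \<partial>lborel) \<le> (\<integral>\<^sup>+y. g (s *\<^sub>R w + (1 - s) *\<^sub>R y) \<partial>lborel)"
      by (intro nn_integral_mono) (auto split: split_indicator simp: algebra_simps)
    then show ?thesis using s by (simp add: nn_integral_affine)
  qed
  have "?I = (\<integral>\<^sup>+y. (\<integral>\<^sup>+w. g (y + s *\<^sub>R (w - y)) * indicator B w * indicator A y \<partial>lborel) \<partial>lborel)"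
    by (simp add: nn_integral_multc)
  also have "\<dots> = (\<integral>\<^sup>+w. (\<integral>\<^sup>+y. g (y + s *\<^sub>R (w - y)) * indicator B w * indicator A y \<partial>lborel) \<partial>lborel)"
    by (rule lborel_pair.Fubini') measurable
  also have "\<dots> = (\<integral>\<^sup>+w\<in>B. (\<integral>\<^sup>+y\<in>A. g (y + s *\<^sub>R (w - y)) \<partial>lborel) \<partial>lborel)"
  proof (intro nn_integral_cong)
    fix w
    show "(\<integral>\<^sup>+y. g (y + s *\<^sub>R (w - y)) * indicator B w * indicator A y \<partial>lborel)
        = (\<integral>\<^sup>+y\<in>A. g (y + s *\<^sub>R (w - y)) \<partial>lborel) * indicator B w"
      by (subst nn_integral_multc[symmetric], measurable, simp add: mult_ac)
  qed
  also have "\<dots> \<le> (\<integral>\<^sup>+w\<in>B. (ennreal (1 / (1 - s) ^ DIM('a)) * (\<integral>\<^sup>+z. g z \<partial>lborel)) \<partial>lborel)"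
    by (intro nn_integral_mono mult_right_mono 2) auto
  also have "\<dots> = ?R2" by (simp add: nn_integral_cmult_indicator, simp add: mult_ac)
  finally show "?I \<le> ?R2" .
qed

text \<open>
  The two preceding bounds combine into one with the factor
  \<open>min (a\<^sup>n / s\<^sup>n) (b\<^sup>n / (1 - s)\<^sup>n) = (a * b)\<^sup>n / (max (s * b) ((1 - s) * a))\<^sup>n\<close>, in which the
  maximum is at least \<open>(s * b + a) / 4\<close> because \<open>a \<le> b\<close>. The result stays bounded as
  \<open>s\<close> tends to \<open>0\<close> or \<open>1\<close>. Here \<open>a\<close> and \<open>b\<close> are the side lengths of cubes with the volumes of
  \<open>A\<close> and \<open>B\<close>.
\<close>

lemma nn_integral_segment_point_le_kernel:
  fixes g :: "'a::euclidean_space \<Rightarrow> ennreal"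
  assumes [measurable]: "g \<in> borel_measurable borel" "A \<in> sets borel" "B \<in> sets borel"
    and s: "0 < s" "s < 1" and ab: "0 < a" "a \<le> b"
    and A: "emeasure lborel A = ennreal (a ^ DIM('a))"
    and B: "emeasure lborel B = ennreal (b ^ DIM('a))"
  shows "(\<integral>\<^sup>+y\<in>A. (\<integral>\<^sup>+w\<in>B. g (y + s *\<^sub>R (w - y)) \<partial>lborel) \<partial>lborel)
           \<le> ennreal ((4 * a * b) ^ DIM('a)) * ennreal (1 / (s * b + a) ^ DIM('a)) * (\<integral>\<^sup>+z. g z \<partial>lborel)"
proof -
  have "0 < b" "0 < s * b" "0 < (1 - s) * a" using ab s by auto
  have key: "a * b / c \<le> 4 * a * b / (s * b + a)" if "s * b + a \<le> 4 * c" "0 < c" for c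
  proof -
    have "a * b / c = 4 * a * b / (4 * c)" by simp
    also have "\<dots> \<le> 4 * a * b / (s * b + a)"
      using that \<open>0 < a\<close> \<open>0 < b\<close> \<open>0 < s * b\<close> by (intro divide_left_mono) auto
    finally show ?thesis .
  qed
  have "(1 - s) * a * 2 + s * b * 2 \<ge> s * b + a"
  proof -
    have "s * a \<le> s * b" "s * a \<le> 1 * a" using ab s by (intro mult_left_mono mult_right_mono; simp)+
    moreover have "(1 - s) * a * 2 = 2 * a - 2 * (s * a)" by (simp add: algebra_simps)
    ultimately show ?thesis by linarith
  qed
  then consider "s * b + a \<le> 4 * (s * b)" | "s * b + a \<le> 4 * ((1 - s) * a)" by linarith
  then show ?thesis
  proof cases
    case 1
    have "1 / s ^ DIM('a) * a ^ DIM('a) = (a * b / (s * b)) ^ DIM('a)"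
      using s \<open>0 < b\<close> by (simp add: power_mult_distrib power_divide)
    also have "\<dots> \<le> (4 * a * b / (s * b + a)) ^ DIM('a)"
      using key[OF 1] \<open>0 < s * b\<close> \<open>0 < b\<close> ab by (intro power_mono divide_nonneg_pos mult_nonneg_nonneg) auto
    finally have "ennreal (1 / s ^ DIM('a)) * emeasure lborel A
        \<le> ennreal ((4 * a * b) ^ DIM('a)) * ennreal (1 / (s * b + a) ^ DIM('a))"
      using s ab by (simp add: A ennreal_mult[symmetric] power_divide ennreal_leI)
    then show ?thesis using s
      by (intro order_trans[OF nn_integral_segment_point_le(1)] mult_right_mono) auto
  next
    case 2
    have "1 / (1 - s) ^ DIM('a) * b ^ DIM('a) = (a * b / ((1 - s) * a)) ^ DIM('a)"
      using s \<open>0 < a\<close> by (simp add: power_mult_distrib power_divide)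
    also have "\<dots> \<le> (4 * a * b / (s * b + a)) ^ DIM('a)"
      using key[OF 2] \<open>0 < (1 - s) * a\<close> \<open>0 < b\<close> ab by (intro power_mono divide_nonneg_pos mult_nonneg_nonneg) auto
    finally have "ennreal (1 / (1 - s) ^ DIM('a)) * emeasure lborel B
        \<le> ennreal ((4 * a * b) ^ DIM('a)) * ennreal (1 / (s * b + a) ^ DIM('a))"
      using s ab by (simp add: B ennreal_mult[symmetric] power_divide ennreal_leI)
    then show ?thesis using s
      by (intro order_trans[OF nn_integral_segment_point_le(2)] mult_right_mono) auto
  qed
qed

text \<open>
  An explicit primitive; \<open>n \<ge> 2\<close> makes the power integrable at infinity, so that only the lower
  end \<open>s * b + a \<ge> \<rho>\<close> counts. The factor \<open>1 / (n - 1)\<close> is estimated by \<open>1\<close>.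
\<close>

lemma nn_integral_inverse_power_linear_le:
  fixes a b \<rho> :: real
  assumes "0 < a" "0 < b" "0 < \<rho>" "2 \<le> n"
  shows "(\<integral>\<^sup>+s\<in>{0<..<1}. ennreal (1 / (s * b + a) ^ n) * indicator {\<rho>..} (s * b + a) \<partial>lborel)
           \<le> ennreal (1 / (b * \<rho> ^ (n - 1)))" (is "?I \<le> _")
proof -
  obtain k where n: "n = Suc (Suc k)" using \<open>2 \<le> n\<close> by (metis One_nat_def Suc_1 Suc_le_D Suc_le_mono)
  define m where "m = Suc k"
  have m: "n = Suc m" "m > 0" by (simp_all add: n m_def)
  \<comment> \<open>The parameter at which \<open>s * b + a\<close> reaches \<open>\<rho>\<close>, clamped to the unit interval.\<close>
  define s\<^sub>0 where "s\<^sub>0 = min 1 (max 0 ((\<rho> - a) / b))"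
  define F where "F s = - (1 / (b * m)) * (1 / (s * b + a) ^ m)" for s
  have s0: "0 \<le> s\<^sub>0" "s\<^sub>0 \<le> 1" by (auto simp: s\<^sub>0_def)
  have pos: "0 < s * b + a" if "0 \<le> s" for s
    using that assms by (simp add: add_nonneg_pos)
  have "?I \<le> (\<integral>\<^sup>+s. ennreal (1 / (s * b + a) ^ n) * indicator {s\<^sub>0..1} s \<partial>lborel)"
  proof (rule nn_integral_mono)
    fix s
    have "s\<^sub>0 \<le> s" if "0 < s" "\<rho> \<le> s * b + a"
      using that \<open>0 < b\<close> by (simp add: s\<^sub>0_def min_le_iff_disj divide_le_eq)
    then show "ennreal (1 / (s * b + a) ^ n) * indicator {\<rho>..} (s * b + a) * indicator {0<..<1} s
        \<le> ennreal (1 / (s * b + a) ^ n) * indicator {s\<^sub>0..1} s" if "s \<in> space lborel"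
      by (auto split: split_indicator)
  qed
  also have "\<dots> = ennreal (F 1 - F s\<^sub>0)"
  proof (rule nn_integral_FTC_Icc)
    fix s assume "s \<in> {s\<^sub>0..1}"
    then have "0 < s * b + a" using s0 by (intro pos) auto
    then show "0 \<le> 1 / (s * b + a) ^ n" by simp
    have "((\<lambda>s. (s * b + a) ^ Suc k) has_real_derivative (1 + real k) * (b * (s * b + a) ^ k)) (at s)"
      by (rule DERIV_power_Suc) (auto intro!: derivative_eq_intros)
    then have "((\<lambda>s. - (1 / (b * m)) * (1 / (s * b + a) ^ Suc k)) has_real_derivative
        - (1 / (b * m)) * ((0 * (s * b + a) ^ Suc k - 1 * ((1 + real k) * (b * (s * b + a) ^ k))) /
          ((s * b + a) ^ Suc k * (s * b + a) ^ Suc k))) (at s)"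
      using \<open>0 < s * b + a\<close> by (intro DERIV_cmult DERIV_divide DERIV_const) auto
    then show "(F has_real_derivative 1 / (s * b + a) ^ n) (at s)"
      unfolding F_def m m_def using \<open>0 < s * b + a\<close> \<open>0 < b\<close>
      by (elim DERIV_cong) (simp add: divide_simps)
  qed (use s0 in auto)
  also have "\<dots> \<le> ennreal (1 / (b * \<rho> ^ (n - 1)))"
  proof (cases "(\<rho> - a) / b \<le> 1")
    case True
    then have rho: "\<rho> \<le> s\<^sub>0 * b + a" using \<open>0 < b\<close> by (auto simp: s\<^sub>0_def field_simps max_def)
    have "F 1 - F s\<^sub>0 \<le> - F s\<^sub>0" using assms pos[of 1] by (simp add: F_def)
    also have "\<dots> = 1 / (b * m * (s\<^sub>0 * b + a) ^ m)" by (simp add: F_def)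
    also have "\<dots> \<le> 1 / (b * 1 * \<rho> ^ m)"
      using assms m rho s0 by (intro divide_left_mono mult_mono power_mono mult_pos_pos) auto
    finally show ?thesis by (simp add: m ennreal_leI)
  next
    case False
    then have "s\<^sub>0 = 1" by (simp add: s\<^sub>0_def)
    then show ?thesis by simp
  qed
  finally show ?thesis .
qed

section \<open>Cubes\<close>

lemma sets_cube [measurable, simp]: "cube a l \<in> sets borel"
  by (simp add: cube_def)

lemma emeasure_cube:
  fixes a :: "real^'n::finite"
  assumes "0 \<le> l"
  shows "emeasure lborel (cube a l) = ennreal (l ^ CARD('n))"
proof -
  have "cube a l \<noteq> {}"
    using assms by (auto simp: cube_def interval_ne_empty_cart)
  then have "measure lborel (cube a l) = l ^ CARD('n)"
    by (simp add: cube_def content_cbox_cart)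
  then show ?thesis
    using emeasure_lborel_cbox_finite[of a "\<chi> i. a $ i + l"]
    by (subst emeasure_eq_ennreal_measure) (auto simp: cube_def)
qed

lemma norm_le_sqrt_card_mult:
  fixes v :: "real^'n::finite"
  assumes "\<And>i. \<bar>v $ i\<bar> \<le> l"
  shows "norm v \<le> sqrt CARD('n) * l"
proof -
  have "0 \<le> l" using assms[of undefined] by linarith
  have "norm v \<le> sqrt (\<Sum>i\<in>(UNIV::'n set). l\<^sup>2)"
    unfolding norm_vec_def L2_set_def using assms \<open>0 \<le> l\<close>
    by (intro real_sqrt_le_mono sum_mono) (metis abs_le_square_iff abs_of_nonneg real_norm_def power2_abs)
  then show ?thesis using \<open>0 \<le> l\<close> by (simp add: real_sqrt_mult)
qed

lemma norm_diff_cube_le: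
  fixes y w :: "real^'n::finite"
  assumes "y \<in> cube a l" "w \<in> cube a l"
  shows "norm (w - y) \<le> sqrt CARD('n) * l"
proof (rule norm_le_sqrt_card_mult)
  fix i
  have "a $ i \<le> y $ i" "y $ i \<le> a $ i + l" "a $ i \<le> w $ i" "w $ i \<le> a $ i + l"
    using assms by (auto simp: cube_def mem_box_cart)
  then show "\<bar>(w - y) $ i\<bar> \<le> l" by simp
qed

lemma segment_in_cube:
  assumes "y \<in> cube a l" "w \<in> cube a l" "0 \<le> s" "s \<le> 1"
  shows "y + s *\<^sub>R (w - y) \<in> cube a l"
proof -
  have "(1 - s) *\<^sub>R y + s *\<^sub>R w \<in> cube a l"
    using assms by (intro convexD) (auto simp: cube_def)
  then show ?thesis by (simp add: algebra_simps)
qed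

section \<open>The gradient along segments\<close>

lemma segment_has_real_derivative:
  fixes f :: "'a::euclidean_space \<Rightarrow> real"
  assumes "\<And>x. (f has_derivative (\<lambda>h. h \<bullet> D x)) (at x)"
  shows "((\<lambda>s. f (y + s *\<^sub>R v)) has_real_derivative v \<bullet> D (y + s *\<^sub>R v)) (at s)"
proof -
  have "((\<lambda>s. y + s *\<^sub>R v) has_derivative (\<lambda>h. h *\<^sub>R v)) (at s)"
    by (auto intro!: derivative_eq_intros)
  from has_derivative_compose[OF this assms] show ?thesis
    by (simp add: has_field_derivative_def mult_commute_abs)
qed

lemma borel_measurable_has_derivative:
  fixes f :: "'a::euclidean_space \<Rightarrow> real"
  assumes "\<And>x. (f has_derivative f' x) (at x)"
  shows "f \<in> borel_measurable borel"
  by (auto intro!: borel_measurable_continuous_onI continuous_at_imp_continuous_on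
      has_derivative_continuous[OF assms])

lemma abs_diff_le_nn_integral_segment:
  fixes f :: "'a::euclidean_space \<Rightarrow> real"
  assumes der: "\<And>x. (f has_derivative (\<lambda>h. h \<bullet> D x)) (at x)" and cont: "continuous_on UNIV D"
  shows "ennreal \<bar>f w - f y\<bar> \<le>
    ennreal (norm (w - y)) * (\<integral>\<^sup>+s\<in>{0<..<1}. ennreal (norm (D (y + s *\<^sub>R (w - y)))) \<partial>lborel)"
proof -
  have [measurable]: "D \<in> borel_measurable borel"
    using cont by (rule borel_measurable_continuous_onI)
  have "ennreal \<bar>f w - f y\<bar> \<le> (\<integral>\<^sup>+s\<in>{0<..<1}. ennreal \<bar>(w - y) \<bullet> D (y + s *\<^sub>R (w - y))\<bar> \<partial>lborel)"
    using abs_diff_le_nn_integral_abs_deriv[of 0 1 "\<lambda>s. f (y + s *\<^sub>R (w - y))"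
        "\<lambda>s. (w - y) \<bullet> D (y + s *\<^sub>R (w - y))"] segment_has_real_derivative[OF der]
    by (simp add: continuous_intros continuous_on_compose2[OF cont])
  also have "\<dots> \<le> (\<integral>\<^sup>+s. ennreal (norm (w - y)) *
      (ennreal (norm (D (y + s *\<^sub>R (w - y)))) * indicator {0<..<1} s) \<partial>lborel)"
    by (intro nn_integral_mono)
       (auto split: split_indicator simp: Cauchy_Schwarz_ineq2 ennreal_leI simp flip: ennreal_mult)
  finally show ?thesis by (simp add: nn_integral_cmult)
qed

lemma layer_width_le_nn_integral_segment:
  fixes f :: "'a::euclidean_space \<Rightarrow> real"
  assumes der: "\<And>x. (f has_derivative (\<lambda>h. h \<bullet> D x)) (at x)" and cont: "continuous_on UNIV D"
    and "c < d"
    and ends: "\<bar>f y\<bar> \<le> c \<and> d \<le> \<bar>f w\<bar> \<or> \<bar>f w\<bar> \<le> c \<and> d \<le> \<bar>f y\<bar>"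
  shows "ennreal (d - c) \<le> ennreal (norm (w - y)) *
    (\<integral>\<^sup>+s\<in>{0<..<1}. ennreal (norm (D (y + s *\<^sub>R (w - y)))) *
       indicator {c<..<d} \<bar>f (y + s *\<^sub>R (w - y))\<bar> \<partial>lborel)"
proof -
  have [measurable]: "D \<in> borel_measurable borel"
    using cont by (rule borel_measurable_continuous_onI)
  have [measurable]: "f \<in> borel_measurable borel"
    by (rule borel_measurable_has_derivative[OF der])
  have "ennreal (d - c) \<le> (\<integral>\<^sup>+s\<in>{0<..<1}. ennreal \<bar>(w - y) \<bullet> D (y + s *\<^sub>R (w - y))\<bar>
      * indicator {c<..<d} \<bar>f (y + s *\<^sub>R (w - y))\<bar> \<partial>lborel)"
    using \<open>c < d\<close> ends
    by (intro crossing_le_nn_integral_abs_deriv segment_has_real_derivative[OF der])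
       (auto intro!: continuous_intros continuous_on_compose2[OF cont])
  also have "\<dots> \<le> (\<integral>\<^sup>+s. ennreal (norm (w - y)) *
      (ennreal (norm (D (y + s *\<^sub>R (w - y)))) * indicator {c<..<d} \<bar>f (y + s *\<^sub>R (w - y))\<bar>
        * indicator {0<..<1} s) \<partial>lborel)"
    by (intro nn_integral_mono)
       (auto split: split_indicator simp: Cauchy_Schwarz_ineq2 ennreal_leI simp flip: ennreal_mult)
  finally show ?thesis by (simp add: nn_integral_cmult)
qed

text \<open>
  Averaging \<open>G\<close> along all segments from \<open>A\<close> to \<open>B\<close> produces a potential of \<open>G\<close> of order 1.
  By Tonelli the weight that a point \<open>z\<close> receives is the integral over \<open>s\<close> of the kernel
  \<open>1 / (s * b + a)\<^sup>n\<close>, restricted to the parameters at which \<open>z\<close> can be reached at all; the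
  indicator encodes this restriction by a lower bound \<open>\<rho> z\<close> for \<open>s * b + a\<close>. Two choices of \<open>\<rho>\<close>
  are needed below. The constant \<open>a\<close> excludes nothing and gives an isoperimetric inequality. The
  distance of \<open>z\<close> from a fixed point, up to a factor, gives the kernel of the Riesz potential.
\<close>

lemma nn_integral_segments_le:
  fixes G :: "'a::euclidean_space \<Rightarrow> ennreal" and \<rho> :: "'a \<Rightarrow> real"
  assumes [measurable]: "G \<in> borel_measurable borel" "\<rho> \<in> borel_measurable borel"
      "A \<in> sets borel" "B \<in> sets borel"
    and dim: "2 \<le> DIM('a)" and \<rho>: "\<And>z. 0 \<le> \<rho> z" and ab: "0 < a" "a \<le> b"
    and A: "emeasure lborel A = ennreal (a ^ DIM('a))"
    and B: "emeasure lborel B = ennreal (b ^ DIM('a))"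
  shows "(\<integral>\<^sup>+y\<in>A. (\<integral>\<^sup>+w\<in>B. (\<integral>\<^sup>+s\<in>{0<..<1}. G (y + s *\<^sub>R (w - y)) *
             indicator {\<rho> (y + s *\<^sub>R (w - y))..} (s * b + a) \<partial>lborel) \<partial>lborel) \<partial>lborel)
           \<le> ennreal ((4 * a * b) ^ DIM('a) / b) * (\<integral>\<^sup>+z. G z / ennreal (\<rho> z ^ (DIM('a) - 1)) \<partial>lborel)"
    (is "?L \<le> _")
proof -
  have "0 < b" using ab by simp
  define g where "g s z = G z * indicator {\<rho> z..} (s * b + a)" for s z
  have g [measurable]: "(\<lambda>(s, z). g s z) \<in> borel_measurable (borel \<Otimes>\<^sub>M borel)"
  proof -
    have "g s z = (if \<rho> z \<le> s * b + a then G z else 0)" for s z by (simp add: g_def)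
    then show ?thesis by simp
  qed
  define H where "H y w s = g s (y + s *\<^sub>R (w - y)) * indicator {0<..<1} s * indicator B w * indicator A y" for y w s
  have "?L = (\<integral>\<^sup>+y. (\<integral>\<^sup>+w. (\<integral>\<^sup>+s. H y w s \<partial>lborel) \<partial>lborel) \<partial>lborel)"
    unfolding H_def g_def[symmetric] by (simp add: nn_integral_multc)
  also have "\<dots> = (\<integral>\<^sup>+y. (\<integral>\<^sup>+s. (\<integral>\<^sup>+w. H y w s \<partial>lborel) \<partial>lborel) \<partial>lborel)"
    unfolding H_def by (intro nn_integral_cong lborel_pair.Fubini') measurable
  also have "\<dots> = (\<integral>\<^sup>+s. (\<integral>\<^sup>+y. (\<integral>\<^sup>+w. H y w s \<partial>lborel) \<partial>lborel) \<partial>lborel)"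
    unfolding H_def by (intro lborel_pair.Fubini') measurable
  also have "\<dots> \<le> (\<integral>\<^sup>+s. ennreal ((4 * a * b) ^ DIM('a)) *
      (\<integral>\<^sup>+z. ennreal (1 / (s * b + a) ^ DIM('a)) * g s z * indicator {0<..<1} s \<partial>lborel) \<partial>lborel)"
  proof (rule nn_integral_mono)
    fix s :: real
    show "(\<integral>\<^sup>+y. (\<integral>\<^sup>+w. H y w s \<partial>lborel) \<partial>lborel) \<le> ennreal ((4 * a * b) ^ DIM('a)) *
      (\<integral>\<^sup>+z. ennreal (1 / (s * b + a) ^ DIM('a)) * g s z * indicator {0<..<1} s \<partial>lborel)"
    proof (cases "0 < s \<and> s < 1")
      case True
      then have "(\<integral>\<^sup>+y. (\<integral>\<^sup>+w. H y w s \<partial>lborel) \<partial>lborel)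
          = (\<integral>\<^sup>+y\<in>A. (\<integral>\<^sup>+w\<in>B. g s (y + s *\<^sub>R (w - y)) \<partial>lborel) \<partial>lborel)"
        by (simp add: H_def nn_integral_multc)
      also have "\<dots> \<le> ennreal ((4 * a * b) ^ DIM('a)) * ennreal (1 / (s * b + a) ^ DIM('a)) * (\<integral>\<^sup>+z. g s z \<partial>lborel)"
        using True ab A B by (intro nn_integral_segment_point_le_kernel) auto
      finally show ?thesis using True by (simp add: nn_integral_cmult mult.assoc)
    qed (auto simp: H_def)
  qed
  also have "\<dots> = ennreal ((4 * a * b) ^ DIM('a)) * (\<integral>\<^sup>+s. (\<integral>\<^sup>+z. ennreal (1 / (s * b + a) ^ DIM('a)) * g s z
        * indicator {0<..<1} s \<partial>lborel) \<partial>lborel)"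
    by (intro nn_integral_cmult) measurable
  also have "(\<integral>\<^sup>+s. (\<integral>\<^sup>+z. ennreal (1 / (s * b + a) ^ DIM('a)) * g s z * indicator {0<..<1} s \<partial>lborel) \<partial>lborel)
     = (\<integral>\<^sup>+z. (\<integral>\<^sup>+s. ennreal (1 / (s * b + a) ^ DIM('a)) * g s z * indicator {0<..<1} s \<partial>lborel) \<partial>lborel)"
    by (intro lborel_pair.Fubini') measurable
  also have "\<dots> \<le> (\<integral>\<^sup>+z. ennreal (1 / b) * (G z / ennreal (\<rho> z ^ (DIM('a) - 1))) \<partial>lborel)"
  proof (rule nn_integral_mono)
    fix z
    have "(\<integral>\<^sup>+s. ennreal (1 / (s * b + a) ^ DIM('a)) * g s z * indicator {0<..<1} s \<partial>lborel)
      = G z * (\<integral>\<^sup>+s\<in>{0<..<1}. ennreal (1 / (s * b + a) ^ DIM('a)) * indicator {\<rho> z..} (s * b + a) \<partial>lborel)"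
      by (subst nn_integral_cmult[symmetric]) (auto simp: g_def mult_ac)
    also have "\<dots> \<le> ennreal (1 / b) * (G z / ennreal (\<rho> z ^ (DIM('a) - 1)))"
    \<comment> \<open>Where \<open>\<rho>\<close> vanishes, the right-hand side is infinite unless \<open>G z = 0\<close>.\<close>
    proof (cases "\<rho> z = 0")
      case True
      then show ?thesis using dim \<open>0 < b\<close>
        by (cases "G z = 0") (auto simp: power_0_left ennreal_mult_top)
    next
      case False
      then have "0 < \<rho> z" using \<rho>[of z] by simp
      then have "(\<integral>\<^sup>+s\<in>{0<..<1}. ennreal (1 / (s * b + a) ^ DIM('a)) * indicator {\<rho> z..} (s * b + a) \<partial>lborel)
          \<le> ennreal (1 / b) * (1 / ennreal (\<rho> z ^ (DIM('a) - 1)))"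
        using nn_integral_inverse_power_linear_le[of a b "\<rho> z" "DIM('a)"] ab dim
        by (simp add: ennreal_mult[symmetric] divide_ennreal flip: ennreal_1)
      from mult_left_mono[OF this, of "G z"] show ?thesis
        by (simp add: mult.commute[of "G z" "ennreal _"] ennreal_times_divide)
    qed
    finally show "(\<integral>\<^sup>+s. ennreal (1 / (s * b + a) ^ DIM('a)) * g s z * indicator {0<..<1} s \<partial>lborel)
      \<le> ennreal (1 / b) * (G z / ennreal (\<rho> z ^ (DIM('a) - 1)))" .
  qed
  also have "\<dots> = ennreal (1 / b) * (\<integral>\<^sup>+z. G z / ennreal (\<rho> z ^ (DIM('a) - 1)) \<partial>lborel)"
    by (intro nn_integral_cmult) measurable
  finally show ?thesis
    using ab by (simp add: mult.assoc[symmetric] ennreal_mult[symmetric] mult_left_mono)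
qed

section \<open>An isoperimetric inequality for layers\<close>

text \<open>
  Every segment from \<open>A\<close> to \<open>B\<close> crosses the layer, so each pair of points contributes at least
  \<open>d - c\<close>. Integrating over all pairs bounds \<open>(d - c) * a\<^sup>n * b\<^sup>n\<close> by
  \<open>sqrt n * l * (4 * a * b)\<^sup>n / (b * a\<^sup>n\<^sup>-\<^sup>1)\<close> times the integral of the gradient over the
  layer; dividing by \<open>a * b\<^sup>n\<^sup>-\<^sup>1\<close> gives the claim.
\<close>

lemma layer_isoperimetric_ordered:
  fixes f :: "real^'n::finite \<Rightarrow> real"
  assumes n: "2 \<le> CARD('n)"
    and der: "\<And>x. (f has_derivative (\<lambda>h. h \<bullet> D x)) (at x)" and cont: "continuous_on UNIV D"
    and [measurable]: "A \<in> sets borel" "B \<in> sets borel"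
    and sub: "A \<subseteq> cube q l" "B \<subseteq> cube q l" and "0 \<le> l"
    and ab: "0 < a" "a \<le> b"
    and A: "emeasure lborel A = ennreal (a ^ CARD('n))"
    and B: "emeasure lborel B = ennreal (b ^ CARD('n))"
    and "c < d"
    and ends: "\<And>y w. y \<in> A \<Longrightarrow> w \<in> B \<Longrightarrow> \<bar>f y\<bar> \<le> c \<and> d \<le> \<bar>f w\<bar> \<or> \<bar>f w\<bar> \<le> c \<and> d \<le> \<bar>f y\<bar>"
  shows "ennreal ((d - c) * (a ^ (CARD('n) - 1) * b)) \<le> ennreal (sqrt CARD('n) * l * 4 ^ CARD('n)) *
    (\<integral>\<^sup>+z\<in>cube q l. ennreal (norm (D z)) * indicator {c<..<d} \<bar>f z\<bar> \<partial>lborel)"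
proof -
  define n where "n = CARD('n)"
  define G where "G z = ennreal (norm (D z)) * indicator {c<..<d} \<bar>f z\<bar> * indicator (cube q l) z" for z
  have [measurable]: "D \<in> borel_measurable borel"
    using cont by (rule borel_measurable_continuous_onI)
  have [measurable]: "f \<in> borel_measurable borel"
    by (rule borel_measurable_has_derivative[OF der])
  have [measurable]: "G \<in> borel_measurable borel" unfolding G_def by measurable
  have "0 < b" using ab by simp
  define I where "I = (\<integral>\<^sup>+z. G z \<partial>lborel)"
  have "ennreal (d - c) \<le> ennreal (sqrt n * l) * (\<integral>\<^sup>+s\<in>{0<..<1}. G (y + s *\<^sub>R (w - y)) *
             indicator {a..} (s * b + a) \<partial>lborel)" if "y \<in> A" "w \<in> B" for y w
  proof -
    have yw: "y \<in> cube q l" "w \<in> cube q l" using sub that by auto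
    have "ennreal (d - c) \<le> ennreal (norm (w - y)) *
      (\<integral>\<^sup>+s\<in>{0<..<1}. ennreal (norm (D (y + s *\<^sub>R (w - y)))) *
         indicator {c<..<d} \<bar>f (y + s *\<^sub>R (w - y))\<bar> \<partial>lborel)"
      by (rule layer_width_le_nn_integral_segment[OF der cont \<open>c < d\<close> ends[OF that]])
    also have "(\<integral>\<^sup>+s\<in>{0<..<1}. ennreal (norm (D (y + s *\<^sub>R (w - y)))) *
         indicator {c<..<d} \<bar>f (y + s *\<^sub>R (w - y))\<bar> \<partial>lborel)
      = (\<integral>\<^sup>+s\<in>{0<..<1}. G (y + s *\<^sub>R (w - y)) * indicator {a..} (s * b + a) \<partial>lborel)"
      using segment_in_cube[OF yw] \<open>0 < b\<close>
      by (intro nn_integral_cong) (auto simp: G_def split: split_indicator)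
    finally show ?thesis
      using norm_diff_cube_le[OF yw]
      by (elim order_trans) (auto simp: n_def intro!: mult_right_mono ennreal_leI)
  qed
  then have "(\<integral>\<^sup>+y\<in>A. (\<integral>\<^sup>+w\<in>B. ennreal (d - c) \<partial>lborel) \<partial>lborel)
     \<le> (\<integral>\<^sup>+y\<in>A. (\<integral>\<^sup>+w\<in>B. ennreal (sqrt n * l) * (\<integral>\<^sup>+s\<in>{0<..<1}. G (y + s *\<^sub>R (w - y)) *
             indicator {a..} (s * b + a) \<partial>lborel) \<partial>lborel) \<partial>lborel)"
    by (auto intro!: nn_integral_mono split: split_indicator)
  also have "\<dots> = ennreal (sqrt n * l) * (\<integral>\<^sup>+y\<in>A. (\<integral>\<^sup>+w\<in>B. (\<integral>\<^sup>+s\<in>{0<..<1}. G (y + s *\<^sub>R (w - y)) *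
             indicator {a..} (s * b + a) \<partial>lborel) \<partial>lborel) \<partial>lborel)"
    by (simp add: nn_integral_cmult mult.assoc)
  also have "\<dots> \<le> ennreal (sqrt n * l) * (ennreal ((4 * a * b) ^ n / b) * (\<integral>\<^sup>+z. G z / ennreal (a ^ (n - 1)) \<partial>lborel))"
    using nn_integral_segments_le[of G "\<lambda>_. a" A B a b] assms(1) ab A B
    by (intro mult_left_mono) (auto simp: n_def)
  also have "(\<integral>\<^sup>+z. G z / ennreal (a ^ (n - 1)) \<partial>lborel) = ennreal (1 / a ^ (n - 1)) * I"
    using ab unfolding I_def
    by (simp add: divide_ennreal_def nn_integral_multc inverse_ennreal mult.commute inverse_eq_divide)
  also have "(\<integral>\<^sup>+y\<in>A. (\<integral>\<^sup>+w\<in>B. ennreal (d - c) \<partial>lborel) \<partial>lborel) = ennreal ((d - c) * (a ^ n * b ^ n))"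
    using \<open>c < d\<close> ab A B
    by (simp add: nn_integral_cmult_indicator n_def, simp add: ennreal_mult[symmetric] mult_ac)
  finally have "ennreal ((d - c) * (a ^ n * b ^ n)) \<le> ennreal (sqrt n * l) *
      (ennreal ((4 * a * b) ^ n / b) * (ennreal (1 / a ^ (n - 1)) * I))" .
  then have main: "ennreal ((d - c) * (a ^ n * b ^ n)) \<le> ennreal (sqrt n * l * ((4 * a * b) ^ n / b) * (1 / a ^ (n - 1))) * I"
  proof -
    have "0 \<le> sqrt n * l" "0 \<le> (4 * a * b) ^ n / b" "0 \<le> 1 / a ^ (n - 1)"
      using ab \<open>0 \<le> l\<close> by auto
    moreover have "ennreal (X * Y * Z) = ennreal X * (ennreal Y * ennreal Z)"
      if "0 \<le> X" "0 \<le> Y" "0 \<le> Z" for X Y Z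
      using that by (simp add: ennreal_mult mult.assoc)
    ultimately have "ennreal (sqrt n * l * ((4 * a * b) ^ n / b) * (1 / a ^ (n - 1))) =
        ennreal (sqrt n * l) * (ennreal ((4 * a * b) ^ n / b) * ennreal (1 / a ^ (n - 1)))"
      by blast
    with \<open>ennreal ((d - c) * (a ^ n * b ^ n)) \<le> _\<close> show ?thesis by (simp only: mult.assoc)
  qed
  obtain m where m: "n = Suc m" using n by (cases n) (auto simp: n_def)
  \<comment> \<open>The common factor that is cancelled from both sides.\<close>
  define k where "k = 1 / (a * b ^ m)"
  have "ennreal k * ennreal ((d - c) * (a ^ n * b ^ n))
      \<le> ennreal k * (ennreal (sqrt n * l * ((4 * a * b) ^ n / b) * (1 / a ^ (n - 1))) * I)"
    by (rule mult_left_mono[OF main]) simp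
  moreover have "k * ((d - c) * (a ^ n * b ^ n)) = (d - c) * (a ^ m * b)"
    using ab \<open>0 < b\<close> by (simp add: k_def m)
  moreover have "k * (sqrt n * l * ((4 * a * b) ^ n / b) * (1 / a ^ (n - 1))) = sqrt n * l * 4 ^ n"
    using ab \<open>0 < b\<close> by (simp add: k_def m power_mult_distrib)
  ultimately show ?thesis
    using ab \<open>0 < b\<close> \<open>c < d\<close> \<open>0 \<le> l\<close>
    by (simp add: mult.assoc[symmetric] ennreal_mult[symmetric] k_def I_def G_def m flip: n_def)
qed

text \<open>
  The preceding estimate in terms of volumes, without an order between them. If one of the sets is
  null, the left-hand side vanishes, since \<open>1 - \<alpha> > 0\<close>.
\<close>

lemma layer_isoperimetric:
  fixes f :: "real^'n::finite \<Rightarrow> real" and E F :: "(real^'n) set"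
  defines "e \<equiv> measure lborel E" and "\<phi> \<equiv> measure lborel F" and "\<alpha> \<equiv> 1 / real CARD('n)"
  assumes n: "2 \<le> CARD('n)"
    and der: "\<And>x. (f has_derivative (\<lambda>h. h \<bullet> D x)) (at x)" and cont: "continuous_on UNIV D"
    and [measurable]: "E \<in> sets borel" "F \<in> sets borel"
    and sub: "E \<subseteq> cube q l" "F \<subseteq> cube q l" and "0 \<le> l" and "c < d"
    and E: "\<And>y. y \<in> E \<Longrightarrow> d \<le> \<bar>f y\<bar>" and F: "\<And>y. y \<in> F \<Longrightarrow> \<bar>f y\<bar> \<le> c"
  shows "ennreal ((d - c) * (min e \<phi> powr (1 - \<alpha>) * max e \<phi> powr \<alpha>))
    \<le> ennreal (sqrt CARD('n) * l * 4 ^ CARD('n)) *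
      (\<integral>\<^sup>+z\<in>cube q l. ennreal (norm (D z)) * indicator {c<..<d} \<bar>f z\<bar> \<partial>lborel)" (is "_ \<le> ?R")
proof (cases "min e \<phi> > 0")
  case False
  then have "min e \<phi> = 0" by (auto simp: e_def \<phi>_def min_def split: if_splits intro: antisym)
  then show ?thesis by simp
next
  case True
  then have pos: "e > 0" "\<phi> > 0" by auto
  have \<alpha>: "real CARD('n) * \<alpha> = 1" using n by (simp add: \<alpha>_def)
  have root: "(v powr \<alpha>) ^ CARD('n) = v" "(v powr \<alpha>) ^ (CARD('n) - 1) = v powr (1 - \<alpha>)" if "v > 0" for v
    using that \<alpha> n by (simp_all add: powr_power of_nat_diff algebra_simps)
  have fin: "emeasure lborel S = ennreal (measure lborel S)" if "S \<subseteq> cube q l" for S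
    using emeasure_mono[OF that, of lborel] emeasure_cube[OF \<open>0 \<le> l\<close>, of q]
    by (intro emeasure_eq_ennreal_measure) (auto simp: top_unique)
  show ?thesis
  proof (cases "e \<le> \<phi>")
    case True
    have "ennreal ((d - c) * ((e powr \<alpha>) ^ (CARD('n) - 1) * \<phi> powr \<alpha>)) \<le> ?R"
      using pos True \<open>c < d\<close> \<open>0 \<le> l\<close> E F sub root fin[OF sub(1)] fin[OF sub(2)]
      by (intro layer_isoperimetric_ordered[OF n der cont, where A=E and B=F])
         (auto simp: e_def \<phi>_def intro!: powr_mono2 simp: \<alpha>_def)
    then show ?thesis using True pos root by simp
  next
    case False
    have "ennreal ((d - c) * ((\<phi> powr \<alpha>) ^ (CARD('n) - 1) * e powr \<alpha>)) \<le> ?R"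
      using pos False \<open>c < d\<close> \<open>0 \<le> l\<close> E F sub root fin[OF sub(1)] fin[OF sub(2)]
      by (intro layer_isoperimetric_ordered[OF n der cont, where A=F and B=E])
         (auto simp: e_def \<phi>_def intro!: powr_mono2 simp: \<alpha>_def)
    then show ?thesis using False pos root by simp
  qed
qed

section \<open>Integration over the levels\<close>

text \<open>
  Each point \<open>z\<close> lies in the layer above \<open>t\<close> for a set of levels \<open>t\<close> of length exactly \<open>h\<close>.
\<close>

lemma nn_integral_layers:
  fixes u :: "'a::euclidean_space \<Rightarrow> real" and G :: "'a \<Rightarrow> ennreal"
  assumes [measurable]: "u \<in> borel_measurable borel" "G \<in> borel_measurable borel" and "0 < h"
  shows "(\<integral>\<^sup>+t. (\<integral>\<^sup>+z. G z * indicator {t<..<t + h} (u z) \<partial>lborel) \<partial>lborel)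
    = ennreal h * (\<integral>\<^sup>+z. G z \<partial>lborel)"
proof -
  have "(\<integral>\<^sup>+t. (\<integral>\<^sup>+z. G z * indicator {t<..<t + h} (u z) \<partial>lborel) \<partial>lborel)
      = (\<integral>\<^sup>+t. (\<integral>\<^sup>+z. G z * indicator {(t, z). t < u z \<and> u z < t + h} (t, z) \<partial>lborel) \<partial>lborel)"
    by (intro nn_integral_cong) (auto split: split_indicator)
  also have "\<dots> = (\<integral>\<^sup>+z. (\<integral>\<^sup>+t. G z * indicator {(t, z). t < u z \<and> u z < t + h} (t, z) \<partial>lborel) \<partial>lborel)"
    by (intro lborel_pair.Fubini') measurable
  also have "\<dots> = (\<integral>\<^sup>+z. (\<integral>\<^sup>+t. G z * indicator {u z - h<..<u z} t \<partial>lborel) \<partial>lborel)"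
    by (intro nn_integral_cong) (auto split: split_indicator)
  also have "\<dots> = (\<integral>\<^sup>+z. ennreal h * G z \<partial>lborel)"
    using \<open>0 < h\<close> by (simp add: nn_integral_cmult_indicator mult.commute)
  finally show ?thesis by (simp add: nn_integral_cmult)
qed

lemma
  fixes u :: "'a \<Rightarrow> real"
  assumes [measurable]: "u \<in> borel_measurable M" "Q \<in> sets M" and fin: "emeasure M Q \<noteq> \<infinity>"
  shows measure_superlevel_add_sublevel:
      "measure M {z \<in> Q. t < \<bar>u z\<bar>} + measure M {z \<in> Q. \<bar>u z\<bar> \<le> t} = measure M Q"
    and borel_measurable_superlevel: "(\<lambda>t. measure M {z \<in> Q. t < \<bar>u z\<bar>}) \<in> borel_measurable borel"
    and borel_measurable_sublevel: "(\<lambda>t. measure M {z \<in> Q. \<bar>u z\<bar> \<le> t}) \<in> borel_measurable borel"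
proof -
  have Q: "Q \<in> fmeasurable M" using fin by (simp add: fmeasurable_def less_top)
  have sub: "Q \<subseteq> space M" using \<open>Q \<in> sets M\<close> by (rule sets.sets_into_space)
  have "{z \<in> Q. t < \<bar>u z\<bar>} = Q \<inter> {z \<in> space M. t < \<bar>u z\<bar>}"
    "{z \<in> Q. \<bar>u z\<bar> \<le> t} = Q \<inter> {z \<in> space M. \<bar>u z\<bar> \<le> t}" for t
    using sub by auto
  then have fm: "{z \<in> Q. t < \<bar>u z\<bar>} \<in> fmeasurable M" "{z \<in> Q. \<bar>u z\<bar> \<le> t} \<in> fmeasurable M" for t
    using Q by (auto intro!: fmeasurable.Int fmeasurable_Int_fmeasurable)
  have "measure M ({z \<in> Q. t < \<bar>u z\<bar>} \<union> {z \<in> Q. \<bar>u z\<bar> \<le> t})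
      = measure M {z \<in> Q. t < \<bar>u z\<bar>} + measure M {z \<in> Q. \<bar>u z\<bar> \<le> t}"
    using fm[of t] by (intro measure_Union) (auto simp: fmeasurable_def)
  moreover have "{z \<in> Q. t < \<bar>u z\<bar>} \<union> {z \<in> Q. \<bar>u z\<bar> \<le> t} = Q" by auto
  ultimately show "measure M {z \<in> Q. t < \<bar>u z\<bar>} + measure M {z \<in> Q. \<bar>u z\<bar> \<le> t} = measure M Q" by simp
  have "mono (\<lambda>t. - measure M {z \<in> Q. t < \<bar>u z\<bar>})"
    using fm by (auto simp: mono_def intro!: measure_mono_fmeasurable dest: fmeasurableD)
  from borel_measurable_uminus[OF borel_measurable_mono[OF this]]
  show "(\<lambda>t. measure M {z \<in> Q. t < \<bar>u z\<bar>}) \<in> borel_measurable borel" by simp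
  have "mono (\<lambda>t. measure M {z \<in> Q. \<bar>u z\<bar> \<le> t})"
    using fm by (auto simp: mono_def intro!: measure_mono_fmeasurable dest: fmeasurableD)
  then show "(\<lambda>t. measure M {z \<in> Q. \<bar>u z\<bar> \<le> t}) \<in> borel_measurable borel"
    by (rule borel_measurable_mono)
qed

text \<open>
  The relative isoperimetric inequality combined with the coarea formula, without perimeters. At
  each level \<open>t\<close> the estimate for the layer of width \<open>\<delta>\<close> is divided by \<open>\<delta>\<close>. As \<open>\<delta>\<close> tends to
  \<open>0\<close>, the sets above the layer increase to \<open>{\<bar>f\<bar> > t}\<close>, whose volume and that of
  \<open>{\<bar>f\<bar> \<le> t}\<close> add up to the volume of the cube. Hence the larger of the two is at least half of
  it and its root at least \<open>l / 2\<close>. Fatou's lemma allows the limit to be taken inside the integral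
  over \<open>t\<close>, and before the limit that integral has the same value for every \<open>\<delta>\<close>.
\<close>

lemma nn_integral_min_level_sets_le:
  fixes f :: "real^'n::finite \<Rightarrow> real" and q :: "real^'n" and l :: real
  defines "\<alpha> \<equiv> 1 / real CARD('n)"
    and "e \<equiv> \<lambda>t. measure lborel {z \<in> cube q l. t < \<bar>f z\<bar>}"
    and "\<phi> \<equiv> \<lambda>t. measure lborel {z \<in> cube q l. \<bar>f z\<bar> \<le> t}"
  assumes n: "2 \<le> CARD('n)" and "0 < l"
    and der: "\<And>x. (f has_derivative (\<lambda>h. h \<bullet> D x)) (at x)" and cont: "continuous_on UNIV D"
  shows "(\<integral>\<^sup>+t. ennreal (min (e t) (\<phi> t) powr (1 - \<alpha>)) \<partial>lborel) \<le>
    ennreal (2 * sqrt CARD('n) * 4 ^ CARD('n)) * (\<integral>\<^sup>+z\<in>cube q l. ennreal (norm (D z)) \<partial>lborel)"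
proof -
  define K where "K = sqrt CARD('n) * l * 4 ^ CARD('n)"
  define \<delta> where "\<delta> k = inverse (real (Suc k))" for k
  define G where "G z = ennreal (norm (D z)) * indicator (cube q l) z" for z
  define N where "N k t = (\<integral>\<^sup>+z. G z * indicator {t<..<t + \<delta> k} \<bar>f z\<bar> \<partial>lborel)" for k t
  have [measurable]: "D \<in> borel_measurable borel"
    using cont by (rule borel_measurable_continuous_onI)
  have [measurable]: "f \<in> borel_measurable borel"
    by (rule borel_measurable_has_derivative[OF der])
  have [measurable]: "G \<in> borel_measurable borel" unfolding G_def by measurable
  have \<delta>: "0 < \<delta> k" for k by (simp add: \<delta>_def)
  have \<delta>0: "\<delta> \<longlonglongrightarrow> 0" unfolding \<delta>_def by (rule LIMSEQ_inverse_real_of_nat)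
  have \<alpha>: "0 < \<alpha>" "\<alpha> < 1" using n by (auto simp: \<alpha>_def)
  have [measurable]: "(\<lambda>t. N k t) \<in> borel_measurable borel" for k
  proof -
    have "N k t = (\<integral>\<^sup>+z. (if t < \<bar>f z\<bar> \<and> \<bar>f z\<bar> < t + \<delta> k then G z else 0) \<partial>lborel)" for t
      unfolding N_def by (intro nn_integral_cong) auto
    then show ?thesis by simp
  qed
  have fin: "emeasure lborel S \<noteq> \<infinity>" if "S \<subseteq> cube q l" for S
    using emeasure_mono[OF that, of lborel] emeasure_cube[of l q] \<open>0 < l\<close> by (auto simp: top_unique)
  have "ennreal (l / 2 * min (e t) (\<phi> t) powr (1 - \<alpha>)) \<le> liminf (\<lambda>k. ennreal (K / \<delta> k) * N k t)" for t
  proof -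
    define E where "E k = {z \<in> cube q l. t + \<delta> k \<le> \<bar>f z\<bar>}" for k
    have [measurable]: "E k \<in> sets borel" for k unfolding E_def by measurable
    have "\<delta> (Suc k) \<le> \<delta> k" for k
      unfolding \<delta>_def by (intro le_imp_inverse_le) auto
    then have "E k \<subseteq> E (Suc k)" for k
      by (auto simp: E_def intro: order_trans[OF add_left_mono])
    then have "incseq E" by (rule incseq_SucI)
    moreover have "(\<Union>k. E k) = {z \<in> cube q l. t < \<bar>f z\<bar>}"
    proof (intro set_eqI iffI)
      fix z assume "z \<in> {z \<in> cube q l. t < \<bar>f z\<bar>}"
      moreover from this obtain k where "\<delta> k < \<bar>f z\<bar> - t"
        using reals_Archimedean[of "\<bar>f z\<bar> - t"] by (auto simp: \<delta>_def)
      ultimately show "z \<in> (\<Union>k. E k)" by (auto simp: E_def intro!: exI[of _ k])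
    next
      fix z assume "z \<in> (\<Union>k. E k)"
      then obtain k where "z \<in> cube q l" "t + \<delta> k \<le> \<bar>f z\<bar>" by (auto simp: E_def)
      then show "z \<in> {z \<in> cube q l. t < \<bar>f z\<bar>}" using \<delta>[of k] by simp
    qed
    ultimately have lim: "(\<lambda>k. measure lborel (E k)) \<longlonglongrightarrow> e t"
      using fin[of "{z \<in> cube q l. t < \<bar>f z\<bar>}"] Lim_measure_incseq[of E lborel]
      by (auto simp: e_def image_subset_iff)
    have sum: "e t + \<phi> t = l ^ CARD('n)"
      using measure_superlevel_add_sublevel[of f lborel "cube q l" t] fin[of "cube q l"]
        emeasure_cube[of l q] \<open>0 < l\<close>
      by (simp add: e_def \<phi>_def measure_def)
    \<comment> \<open>One of the two level sets fills at least half of the cube.\<close>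
    have "(l / 2) ^ CARD('n) \<le> l ^ CARD('n) / 2"
      using \<open>0 < l\<close> power_increasing[of 1 "CARD('n)" "2::real"]
      unfolding power_divide by (intro divide_left_mono) auto
    also have "\<dots> \<le> max (e t) (\<phi> t)" using sum by linarith
    finally have big: "(l / 2) ^ CARD('n) \<le> max (e t) (\<phi> t)" .
    then have "((l / 2) ^ CARD('n)) powr \<alpha> \<le> max (e t) (\<phi> t) powr \<alpha>"
      using \<alpha> \<open>0 < l\<close> by (intro powr_mono2) auto
    then have "l / 2 \<le> max (e t) (\<phi> t) powr \<alpha>"
      using \<open>0 < l\<close> n by (simp add: powr_powr \<alpha>_def flip: powr_realpow)
    then have "l / 2 * min (e t) (\<phi> t) powr (1 - \<alpha>) \<le> min (e t) (\<phi> t) powr (1 - \<alpha>) * max (e t) (\<phi> t) powr \<alpha>"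
      by (subst mult.commute) (intro mult_left_mono, auto)
    then have "ennreal (l / 2 * min (e t) (\<phi> t) powr (1 - \<alpha>))
        \<le> ennreal (min (e t) (\<phi> t) powr (1 - \<alpha>) * max (e t) (\<phi> t) powr \<alpha>)"
      by (rule ennreal_leI)
    also have "\<dots> = liminf (\<lambda>k. ennreal (min (measure lborel (E k)) (\<phi> t) powr (1 - \<alpha>) *
        max (measure lborel (E k)) (\<phi> t) powr \<alpha>))"
      using \<alpha> lim
      by (intro lim_imp_Liminf[symmetric] tendsto_ennrealI tendsto_mult tendsto_powr'
          tendsto_min tendsto_max tendsto_const)
         (auto simp: \<phi>_def intro!: always_eventually le_max_iff_disj[THEN iffD2])
    also have "\<dots> \<le> liminf (\<lambda>k. ennreal (K / \<delta> k) * N k t)"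
    proof (intro Liminf_mono always_eventually allI)
      fix k
      define X where "X = min (measure lborel (E k)) (\<phi> t) powr (1 - \<alpha>) * max (measure lborel (E k)) (\<phi> t) powr \<alpha>"
      have N: "N k t = (\<integral>\<^sup>+z\<in>cube q l. ennreal (norm (D z)) * indicator {t<..<t + \<delta> k} \<bar>f z\<bar> \<partial>lborel)"
        unfolding N_def G_def by (intro nn_integral_cong) (auto split: split_indicator)
      have "ennreal ((t + \<delta> k - t) * X) \<le> ennreal K * N k t"
        unfolding X_def \<phi>_def \<alpha>_def K_def N
        using \<delta>[of k] \<open>0 < l\<close>
        by (intro layer_isoperimetric[OF n der cont]) (auto simp: E_def)
      then have "ennreal (1 / \<delta> k) * ennreal (\<delta> k * X) \<le> ennreal (1 / \<delta> k) * (ennreal K * N k t)"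
        by (intro mult_left_mono) simp_all
      moreover have "ennreal (1 / \<delta> k) * ennreal (\<delta> k * X) = ennreal X"
        using \<delta>[of k] by (simp add: X_def flip: ennreal_mult)
      moreover have "ennreal (1 / \<delta> k) * (ennreal K * N k t) = ennreal (K / \<delta> k) * N k t"
        using \<delta>[of k] \<open>0 < l\<close> by (simp add: mult.assoc[symmetric] K_def flip: ennreal_mult)
      ultimately show "ennreal (min (measure lborel (E k)) (\<phi> t) powr (1 - \<alpha>) *
          max (measure lborel (E k)) (\<phi> t) powr \<alpha>) \<le> ennreal (K / \<delta> k) * N k t"
        by (simp add: X_def)
    qed
    finally show ?thesis .
  qed
  then have "(\<integral>\<^sup>+t. ennreal (l / 2 * min (e t) (\<phi> t) powr (1 - \<alpha>)) \<partial>lborel)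
      \<le> (\<integral>\<^sup>+t. liminf (\<lambda>k. ennreal (K / \<delta> k) * N k t) \<partial>lborel)"
    by (intro nn_integral_mono)
  also have "\<dots> \<le> liminf (\<lambda>k. \<integral>\<^sup>+t. ennreal (K / \<delta> k) * N k t \<partial>lborel)"
    by (intro nn_integral_liminf) measurable
  also have "(\<lambda>k. \<integral>\<^sup>+t. ennreal (K / \<delta> k) * N k t \<partial>lborel) = (\<lambda>k. ennreal K * (\<integral>\<^sup>+z. G z \<partial>lborel))"
  proof
    fix k
    have "(\<integral>\<^sup>+t. ennreal (K / \<delta> k) * N k t \<partial>lborel) = ennreal (K / \<delta> k) * (ennreal (\<delta> k) * (\<integral>\<^sup>+z. G z \<partial>lborel))"
      using nn_integral_layers[of "\<lambda>z. \<bar>f z\<bar>" G "\<delta> k"] \<delta>[of k]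
      by (simp add: nn_integral_cmult) (simp add: N_def)
    then show "(\<integral>\<^sup>+t. ennreal (K / \<delta> k) * N k t \<partial>lborel) = ennreal K * (\<integral>\<^sup>+z. G z \<partial>lborel)"
      using \<delta>[of k] \<open>0 < l\<close> by (simp add: mult.assoc[symmetric] ennreal_mult[symmetric] K_def)
  qed
  finally have main: "(\<integral>\<^sup>+t. ennreal (l / 2 * min (e t) (\<phi> t) powr (1 - \<alpha>)) \<partial>lborel)
      \<le> ennreal K * (\<integral>\<^sup>+z. G z \<partial>lborel)"
    by (simp add: Liminf_const)
  have [measurable]: "e \<in> borel_measurable borel" "\<phi> \<in> borel_measurable borel"
    unfolding e_def \<phi>_def using fin[of "cube q l"]
    by (auto intro!: borel_measurable_superlevel borel_measurable_sublevel)
  have "ennreal (2 / l) * (\<integral>\<^sup>+t. ennreal (l / 2 * min (e t) (\<phi> t) powr (1 - \<alpha>)) \<partial>lborel)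
      = (\<integral>\<^sup>+t. ennreal (2 / l) * ennreal (l / 2 * min (e t) (\<phi> t) powr (1 - \<alpha>)) \<partial>lborel)"
    by (intro nn_integral_cmult[symmetric]) measurable
  also have "\<dots> = (\<integral>\<^sup>+t. ennreal (min (e t) (\<phi> t) powr (1 - \<alpha>)) \<partial>lborel)"
    using \<open>0 < l\<close> by (simp flip: ennreal_mult)
  finally have "(\<integral>\<^sup>+t. ennreal (min (e t) (\<phi> t) powr (1 - \<alpha>)) \<partial>lborel)
     \<le> ennreal (2 / l) * (ennreal K * (\<integral>\<^sup>+z. G z \<partial>lborel))"
    using mult_left_mono[OF main, of "ennreal (2 / l)"] by simp
  also have "\<dots> = ennreal (2 * sqrt CARD('n) * 4 ^ CARD('n)) * (\<integral>\<^sup>+z. G z \<partial>lborel)"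
    using \<open>0 < l\<close> by (simp add: mult.assoc[symmetric] K_def flip: ennreal_mult)
  finally show ?thesis by (simp add: G_def)
qed

section \<open>Lorentz norms over a cube\<close>

text \<open>
  For \<open>u \<le> 1 / 2\<close> the last term is already the left-hand side. For larger \<open>u\<close> use
  \<open>u powr \<beta> \<le> 1 = u + (1 - u)\<close>. The coefficient \<open>1\<close> of the linear term is what keeps the
  constant in front of the Hardy-Littlewood maximal function equal to the exponent.
\<close>

lemma powr_le_add_min_powr:
  fixes u \<beta> :: real
  assumes "0 \<le> u" "u \<le> 1" "0 \<le> \<beta>" "\<beta> \<le> 1"
  shows "u powr \<beta> \<le> u + min u (1 - u) powr \<beta>"
proof (cases "u \<le> 1 / 2")
  case True
  then show ?thesis using assms by (simp add: min_def)
next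
  case False
  have "u powr \<beta> \<le> 1" using assms by (intro powr_le1) auto
  moreover have "1 - u \<le> (1 - u) powr \<beta>"
    using powr_mono'[of \<beta> 1 "1 - u"] assms by simp
  ultimately show ?thesis using False by (simp add: min_def)
qed

lemma lorentz_norm_1:
  assumes "0 < p"
  shows "lorentz_norm p 1 M f = ennreal p *
    (\<integral>\<^sup>+t\<in>{0<..}. ennreal_powr (emeasure M {x \<in> space M. t < \<bar>f x\<bar>}) (1 / p) \<partial>lborel)"
proof -
  have "ennreal_powr u 1 = u" for u
    by (cases u) (auto simp: ennreal_powr_def)
  moreover have "ennreal (t powr 1) * X / ennreal t = X" if "0 < t" for t :: real and X
    using that ennreal_mult_divide_eq[of "ennreal t" X] by (simp add: mult.commute)
  ultimately show ?thesis
    unfolding lorentz_norm_def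
    by (auto intro!: arg_cong[where f="(*) (ennreal p)"] nn_integral_cong split: split_indicator)
qed

lemma nn_integral_level_sets:
  fixes u :: "'a \<Rightarrow> real"
  assumes "sigma_finite_measure M" and [measurable]: "u \<in> borel_measurable M" "A \<in> sets M"
  shows "(\<integral>\<^sup>+t\<in>{0<..}. emeasure M {x \<in> A. t < \<bar>u x\<bar>} \<partial>lborel) = (\<integral>\<^sup>+x\<in>A. ennreal \<bar>u x\<bar> \<partial>M)"
proof -
  interpret sigma_finite_measure M by fact
  interpret pair_sigma_finite lborel M ..
  define F :: "real \<Rightarrow> 'a \<Rightarrow> ennreal" where "F t x = (if x \<in> A \<and> 0 < t \<and> t < \<bar>u x\<bar> then 1 else 0)" for t x
  have sub: "A \<subseteq> space M" using \<open>A \<in> sets M\<close> by (rule sets.sets_into_space)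
  have "emeasure M {x \<in> A. t < \<bar>u x\<bar>} * indicator {0<..} t = (\<integral>\<^sup>+x. F t x \<partial>M)" for t :: real
  proof (cases "0 < t")
    case True
    have "{x \<in> A. t < \<bar>u x\<bar>} = {x \<in> space M. x \<in> A \<and> t < \<bar>u x\<bar>}" using sub by auto
    moreover have "{x \<in> space M. x \<in> A \<and> t < \<bar>u x\<bar>} \<in> sets M" by measurable
    ultimately have "emeasure M {x \<in> A. t < \<bar>u x\<bar>} = (\<integral>\<^sup>+x. indicator {x \<in> A. t < \<bar>u x\<bar>} x \<partial>M)"
      by (metis nn_integral_indicator)
    also have "\<dots> = (\<integral>\<^sup>+x. F t x \<partial>M)"
      using True by (intro nn_integral_cong) (auto simp: F_def)
    finally show ?thesis using True by simp
  qed (simp add: F_def)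
  then have "(\<integral>\<^sup>+t\<in>{0<..}. emeasure M {x \<in> A. t < \<bar>u x\<bar>} \<partial>lborel) = (\<integral>\<^sup>+t. (\<integral>\<^sup>+x. F t x \<partial>M) \<partial>lborel)"
    by (intro nn_integral_cong)
  also have "\<dots> = (\<integral>\<^sup>+x. (\<integral>\<^sup>+t. F t x \<partial>lborel) \<partial>M)"
    unfolding F_def by (intro Fubini'[symmetric]) measurable
  also have "\<dots> = (\<integral>\<^sup>+x. ennreal \<bar>u x\<bar> * indicator A x \<partial>M)"
  proof (intro nn_integral_cong)
    fix x
    have "(\<integral>\<^sup>+t. F t x \<partial>lborel) = (\<integral>\<^sup>+t. indicator A x * indicator {0<..<\<bar>u x\<bar>} t \<partial>lborel)"
      by (intro nn_integral_cong) (auto simp: F_def split: split_indicator)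
    also have "\<dots> = indicator A x * emeasure lborel {0<..<\<bar>u x\<bar>}"
      by (rule nn_integral_cmult_indicator) simp
    finally show "(\<integral>\<^sup>+t. F t x \<partial>lborel) = ennreal \<bar>u x\<bar> * indicator A x"
      by (simp add: mult.commute)
  qed
  finally show ?thesis .
qed

text \<open>
  With \<open>u\<close> the relative volume of \<open>{\<bar>f\<bar> > t}\<close>, the norm is \<open>p\<close> times the integral over \<open>t\<close> of
  \<open>u powr (1 - 1 / n)\<close>. The splitting \<open>powr_le_add_min_powr\<close> separates the average of
  \<open>\<bar>f\<bar>\<close>, by the layer cake formula, from the isoperimetric integral, and the scaling by \<open>l\<close>
  turns the latter into the fractional average of the gradient.
\<close>

lemma lorentz_norm_cube_le:
  fixes f :: "real^'n::finite \<Rightarrow> real" and q :: "real^'n"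
  assumes n: "2 \<le> CARD('n)" and "0 < l"
    and der: "\<And>x. (f has_derivative (\<lambda>h. h \<bullet> D x)) (at x)" and cont: "continuous_on UNIV D"
  defines "p \<equiv> dual_exponent CARD('n)"
  shows "lorentz_norm p 1 (uniform_measure lborel (cube q l)) f
    \<le> ennreal (p * (2 * sqrt CARD('n) * 4 ^ CARD('n))) * (ennreal l * cube_average (\<lambda>y. norm (D y)) (cube q l))
      + ennreal p * cube_average f (cube q l)"
proof -
  define n where "n = CARD('n)"
  define Q where "Q = cube q l"
  define \<alpha> where "\<alpha> = 1 / real n"
  define e where "e t = measure lborel {z \<in> Q. t < \<bar>f z\<bar>}" for t
  define \<phi> where "\<phi> t = measure lborel {z \<in> Q. \<bar>f z\<bar> \<le> t}" for t
  define K where "K = 2 * sqrt n * 4 ^ n"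
  define I where "I = (\<integral>\<^sup>+z\<in>Q. ennreal (norm (D z)) \<partial>lborel)"
  have p: "0 < p" "1 / p = 1 - \<alpha>" using n
    by (auto simp: p_def \<alpha>_def n_def dual_exponent_def field_simps)
  have \<alpha>: "0 < \<alpha>" "\<alpha> < 1" using n by (auto simp: \<alpha>_def n_def)
  have [measurable]: "D \<in> borel_measurable borel"
    using cont by (rule borel_measurable_continuous_onI)
  have [measurable]: "f \<in> borel_measurable borel"
    by (rule borel_measurable_has_derivative[OF der])
  have [measurable]: "Q \<in> sets borel" by (simp add: Q_def)
  have Q: "emeasure lborel Q = ennreal (l ^ n)"
    using emeasure_cube[of l q] \<open>0 < l\<close> by (simp add: Q_def n_def)
  have fin: "emeasure lborel S \<noteq> \<infinity>" if "S \<subseteq> Q" for S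
    using emeasure_mono[OF that, of lborel] Q by (auto simp: top_unique)
  have e: "emeasure lborel {z \<in> Q. t < \<bar>f z\<bar>} = ennreal (e t)" for t
    unfolding e_def using fin[of "{z \<in> Q. t < \<bar>f z\<bar>}"] by (intro emeasure_eq_ennreal_measure) auto
  have sum: "e t + \<phi> t = l ^ n" for t
    using measure_superlevel_add_sublevel[of f lborel Q t] Q \<open>0 < l\<close>
    by (simp add: e_def \<phi>_def measure_def)
  have nonneg: "0 \<le> e t" "0 \<le> \<phi> t" for t by (auto simp: e_def \<phi>_def)
  have lev: "ennreal_powr (emeasure (uniform_measure lborel Q) {x \<in> space (uniform_measure lborel Q). t < \<bar>f x\<bar>}) (1 / p)
      \<le> ennreal (1 / l ^ n) * emeasure lborel {z \<in> Q. t < \<bar>f z\<bar>}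
        + ennreal (1 / l ^ (n - 1)) * ennreal (min (e t) (\<phi> t) powr (1 - \<alpha>))" for t
  proof -
    have "Q \<inter> {x. t < \<bar>f x\<bar>} = {z \<in> Q. t < \<bar>f z\<bar>}" by auto
    then have "emeasure (uniform_measure lborel Q) {x \<in> space (uniform_measure lborel Q). t < \<bar>f x\<bar>} = ennreal (e t / l ^ n)"
      using \<open>0 < l\<close> nonneg[of t] by (simp add: Q e divide_ennreal)
    then have "ennreal_powr (emeasure (uniform_measure lborel Q) {x \<in> space (uniform_measure lborel Q). t < \<bar>f x\<bar>}) (1 / p)
        = ennreal ((e t / l ^ n) powr (1 - \<alpha>))"
      using \<open>0 < l\<close> nonneg[of t] by (simp add: ennreal_powr_def p(2))
    also have "\<dots> \<le> ennreal (e t / l ^ n + min (e t / l ^ n) (1 - e t / l ^ n) powr (1 - \<alpha>))"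
      using \<alpha> \<open>0 < l\<close> nonneg[of t] sum[of t] by (intro ennreal_leI powr_le_add_min_powr) (auto simp: divide_le_eq)
    also have "1 - e t / l ^ n = \<phi> t / l ^ n"
      using sum[of t] \<open>0 < l\<close> by (simp add: field_simps)
    also have "min (e t / l ^ n) (\<phi> t / l ^ n) = min (e t) (\<phi> t) / l ^ n"
      using \<open>0 < l\<close> by (simp add: min_divide_distrib_right)
    also have "(min (e t) (\<phi> t) / l ^ n) powr (1 - \<alpha>) = 1 / l ^ (n - 1) * min (e t) (\<phi> t) powr (1 - \<alpha>)"
    proof -
      have "(l ^ n) powr (1 - \<alpha>) = l ^ (n - 1)"
        using \<open>0 < l\<close> n by (simp add: powr_powr \<alpha>_def n_def algebra_simps of_nat_diff flip: powr_realpow)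
      then show ?thesis using nonneg[of t] \<open>0 < l\<close> by (simp add: powr_divide)
    qed
    also have "ennreal (e t / l ^ n + 1 / l ^ (n - 1) * min (e t) (\<phi> t) powr (1 - \<alpha>))
      = ennreal (1 / l ^ n) * ennreal (e t) + ennreal (1 / l ^ (n - 1)) * ennreal (min (e t) (\<phi> t) powr (1 - \<alpha>))"
      using \<open>0 < l\<close> nonneg[of t] by (simp flip: ennreal_mult ennreal_plus)
    finally show ?thesis by (simp add: e)
  qed
  have [measurable]: "e \<in> borel_measurable borel" "\<phi> \<in> borel_measurable borel"
    unfolding e_def[abs_def] \<phi>_def[abs_def] using Q
    by (auto intro!: borel_measurable_superlevel borel_measurable_sublevel)
  have "(\<integral>\<^sup>+t\<in>{0<..}. ennreal_powr (emeasure (uniform_measure lborel Q)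
        {x \<in> space (uniform_measure lborel Q). t < \<bar>f x\<bar>}) (1 / p) \<partial>lborel)
    \<le> (\<integral>\<^sup>+t. ennreal (1 / l ^ n) * (emeasure lborel {z \<in> Q. t < \<bar>f z\<bar>} * indicator {0<..} t)
        + ennreal (1 / l ^ (n - 1)) * ennreal (min (e t) (\<phi> t) powr (1 - \<alpha>)) \<partial>lborel)"
    using lev by (intro nn_integral_mono) (auto split: split_indicator)
  also have "\<dots> = ennreal (1 / l ^ n) * (\<integral>\<^sup>+t\<in>{0<..}. emeasure lborel {z \<in> Q. t < \<bar>f z\<bar>} \<partial>lborel)
      + ennreal (1 / l ^ (n - 1)) * (\<integral>\<^sup>+t. ennreal (min (e t) (\<phi> t) powr (1 - \<alpha>)) \<partial>lborel)"
    by (simp add: e nn_integral_add nn_integral_cmult)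
  also have "(\<integral>\<^sup>+t\<in>{0<..}. emeasure lborel {z \<in> Q. t < \<bar>f z\<bar>} \<partial>lborel) = (\<integral>\<^sup>+z\<in>Q. ennreal \<bar>f z\<bar> \<partial>lborel)"
    by (intro nn_integral_level_sets lborel.sigma_finite_measure_axioms) auto
  also have "ennreal (1 / l ^ n) * (\<integral>\<^sup>+z\<in>Q. ennreal \<bar>f z\<bar> \<partial>lborel) = cube_average f Q"
    using \<open>0 < l\<close> by (simp add: cube_average_def Q divide_ennreal_def inverse_ennreal inverse_eq_divide mult.commute)
  also have "(\<integral>\<^sup>+t. ennreal (min (e t) (\<phi> t) powr (1 - \<alpha>)) \<partial>lborel) \<le> ennreal K * I"
    unfolding e_def \<phi>_def \<alpha>_def K_def I_def Q_def n_def
    by (rule nn_integral_min_level_sets_le[OF n \<open>0 < l\<close> der cont])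
  also have "ennreal (1 / l ^ (n - 1)) * (ennreal K * I) = ennreal K * (ennreal l * cube_average (\<lambda>y. norm (D y)) Q)"
  proof -
    have "1 / l ^ (n - 1) = l * (1 / l ^ n)" using n \<open>0 < l\<close> by (cases n) (auto simp: n_def)
    moreover have "cube_average (\<lambda>y. norm (D y)) Q = ennreal (1 / l ^ n) * I"
      using \<open>0 < l\<close> by (simp add: cube_average_def Q I_def divide_ennreal_def inverse_ennreal inverse_eq_divide mult.commute)
    ultimately show ?thesis using \<open>0 < l\<close> by (simp only: ennreal_mult less_imp_le zero_le_divide_1_iff zero_le_power mult_ac)
  qed
  finally have "(\<integral>\<^sup>+t\<in>{0<..}. ennreal_powr (emeasure (uniform_measure lborel Q)
        {x \<in> space (uniform_measure lborel Q). t < \<bar>f x\<bar>}) (1 / p) \<partial>lborel)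
    \<le> cube_average f Q + ennreal K * (ennreal l * cube_average (\<lambda>y. norm (D y)) Q)"
    by (simp add: add_left_mono mult_left_mono)
  then have "lorentz_norm p 1 (uniform_measure lborel Q) f
      \<le> ennreal p * (cube_average f Q + ennreal K * (ennreal l * cube_average (\<lambda>y. norm (D y)) Q))"
    unfolding lorentz_norm_1[OF p(1)] by (rule mult_left_mono) simp
  also have "\<dots> = ennreal (p * K) * (ennreal l * cube_average (\<lambda>y. norm (D y)) Q) + ennreal p * cube_average f Q"
    using p by (simp add: distrib_left ennreal_mult K_def mult.assoc add.commute)
  finally show ?thesis by (simp add: Q_def K_def n_def)
qed

section \<open>Comparison with the Riesz potential\<close>

lemma divide_ennreal_divide:
  fixes v :: ennreal
  assumes "0 < c" "0 \<le> t"
  shows "v / ennreal (t / c) = ennreal c * (v / ennreal t)"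
proof (cases "t = 0")
  case True
  then show ?thesis using assms by (cases "v = 0") (auto simp: divide_ennreal_def ennreal_mult_top)
next
  case False
  then have "ennreal (c / t) = ennreal c * ennreal (inverse t)"
    using assms by (simp add: divide_inverse flip: ennreal_mult)
  with False show ?thesis using assms
    by (simp add: divide_ennreal_def inverse_ennreal mult.left_commute)
qed

text \<open>
  On the set where \<open>t \<le> c * r\<close>, the constant kernel \<open>1 / r\<^sup>m\<close> is dominated by \<open>c\<^sup>m / t\<^sup>m\<close>. At the
  singularity \<open>t = 0\<close> the quotient \<open>v / 0\<close> is infinite for \<open>v \<noteq> 0\<close> and \<open>0\<close> for \<open>v = 0\<close>.
\<close>

lemma inverse_power_mult_le_divide:
  fixes v :: ennreal and c r t :: real
  assumes "0 \<le> t" "t \<le> c * r" "0 < r" "0 < c"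
  shows "ennreal (1 / r ^ m) * v \<le> ennreal (c ^ m) * (v / ennreal (t ^ m))"
proof (cases "t ^ m = 0")
  case True
  then show ?thesis unfolding True using assms by (cases "v = 0") (simp_all add: ennreal_mult_top)
next
  case False
  with zero_le_power[OF \<open>0 \<le> t\<close>, of m] have "0 < t ^ m" by linarith
  have "t ^ m \<le> (c * r) ^ m" using assms by (intro power_mono) auto
  then have "c ^ m / (c * r) ^ m \<le> c ^ m / t ^ m"
    using \<open>0 < t ^ m\<close> assms by (intro divide_left_mono) auto
  moreover have "c ^ m / (c * r) ^ m = 1 / r ^ m"
    using assms by (simp add: power_mult_distrib)
  ultimately have "1 / r ^ m \<le> c ^ m * inverse (t ^ m)"
    by (simp only: divide_inverse)
  then have "ennreal (1 / r ^ m) * v \<le> ennreal (c ^ m * inverse (t ^ m)) * v"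
    by (intro mult_right_mono ennreal_leI) auto
  also have "\<dots> = ennreal (c ^ m) * (v / ennreal (t ^ m))"
    using \<open>0 < t ^ m\<close> assms by (simp add: divide_ennreal_def inverse_ennreal ennreal_mult mult_ac)
  finally show ?thesis .
qed

lemma fractional_maximal_1_le_riesz:
  fixes g :: "real^'n::finite \<Rightarrow> real"
  assumes n: "2 \<le> CARD('n)" and [measurable]: "g \<in> borel_measurable borel"
  shows "fractional_maximal_1 g x \<le>
    ennreal (sqrt CARD('n) ^ (CARD('n) - 1)) * riesz_potential_1 (\<lambda>y. ennreal \<bar>g y\<bar>) x"
  unfolding fractional_maximal_1_def
proof (rule SUP_least, clarify)
  fix a :: "real^'n" and l assume "(a, l) \<in> cubes_at x"
  then have l: "0 < l" and x: "x \<in> cube a l" by (auto simp: cubes_at_def)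
  define m where "m = CARD('n) - 1"
  have N: "CARD('n) = Suc m" "m > 0" using n by (auto simp: m_def)
  have "ennreal l * cube_average g (cube a l) = ennreal (1 / l ^ m) * (\<integral>\<^sup>+y\<in>cube a l. ennreal \<bar>g y\<bar> \<partial>lborel)"
  proof -
    have "1 / l ^ m = l * (1 / l ^ CARD('n))" using N l by simp
    then have "ennreal (1 / l ^ m) = ennreal l * ennreal (1 / l ^ CARD('n))"
      using l by (simp flip: ennreal_mult)
    then show ?thesis using l
      by (simp add: cube_average_def emeasure_cube divide_ennreal_def inverse_ennreal inverse_eq_divide mult_ac)
  qed
  also have "\<dots> = (\<integral>\<^sup>+y. ennreal (1 / l ^ m) * (ennreal \<bar>g y\<bar> * indicator (cube a l) y) \<partial>lborel)"
    by (simp add: nn_integral_cmult)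
  also have "\<dots> \<le> (\<integral>\<^sup>+y. ennreal (sqrt CARD('n) ^ m) * (ennreal \<bar>g y\<bar> / ennreal (norm (x - y) ^ m)) \<partial>lborel)"
    using l N(2) norm_diff_cube_le[OF _ x]
    by (intro nn_integral_mono) (auto split: split_indicator intro!: inverse_power_mult_le_divide)
  also have "\<dots> = ennreal (sqrt CARD('n) ^ m) * riesz_potential_1 (\<lambda>y. ennreal \<bar>g y\<bar>) x"
    by (simp add: nn_integral_cmult riesz_potential_1_def m_def)
  finally show "ennreal l * cube_average g (cube a l) \<le>
      ennreal (sqrt CARD('n) ^ (CARD('n) - 1)) * riesz_potential_1 (\<lambda>y. ennreal \<bar>g y\<bar>) x"
    by (simp add: m_def)
qed

text \<open>
  To recover \<open>f\<close> from its gradient, every \<open>y\<close> in the cube is compared with every \<open>w\<close> in a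
  larger cube \<open>R\<close> that also contains \<open>x\<close>, where the average of \<open>\<bar>f\<bar>\<close> is small if
  \<open>L\<close> is large. The increments along the segments are bounded by the gradient. The point at parameter \<open>s\<close> has distance at most
  \<open>sqrt n * (s * L + l)\<close> from \<open>x\<close>, hence a point \<open>z\<close> is reached only if \<open>s * L + l\<close> is at least
  \<open>norm (x - z) / sqrt n\<close>. With this \<open>\<rho>\<close> the potential of \<open>nn_integral_segments_le\<close> is the Riesz
  potential at \<open>x\<close>, with a constant independent of \<open>L\<close>.
\<close>

lemma cube_average_le_riesz_add:
  fixes f :: "real^'n::finite \<Rightarrow> real" and q x :: "real^'n"
  assumes n: "2 \<le> CARD('n)" and x: "x \<in> cube q l" and "0 < l" "l \<le> L"
    and der: "\<And>x. (f has_derivative (\<lambda>h. h \<bullet> D x)) (at x)" and cont: "continuous_on UNIV D"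
  shows "cube_average f (cube q l) \<le>
      ennreal (2 * sqrt CARD('n) * 4 ^ CARD('n) * sqrt CARD('n) ^ (CARD('n) - 1)) *
        riesz_potential_1 (\<lambda>z. ennreal (norm (D z))) x
      + ennreal (1 / L ^ CARD('n)) * (\<integral>\<^sup>+w. ennreal \<bar>f w\<bar> \<partial>lborel)"
proof -
  define n where "n = CARD('n)"
  define Q where "Q = cube q l"
  define R where "R = cube x L"
  define \<rho> where "\<rho> z = norm (x - z) / sqrt n" for z
  define G where "G z = ennreal (norm (D z))" for z
  define J where "J = (\<integral>\<^sup>+w. ennreal \<bar>f w\<bar> \<partial>lborel)"
  have [measurable]: "D \<in> borel_measurable borel"
    using cont by (rule borel_measurable_continuous_onI)
  have [measurable]: "f \<in> borel_measurable borel"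
    by (rule borel_measurable_has_derivative[OF der])
  have [measurable]: "Q \<in> sets borel" "R \<in> sets borel" "G \<in> borel_measurable borel" "\<rho> \<in> borel_measurable borel"
    unfolding Q_def R_def G_def \<rho>_def by measurable
  have "0 < L" "0 < sqrt n" using assms by (auto simp: n_def)
  have Q: "emeasure lborel Q = ennreal (l ^ n)" and R: "emeasure lborel R = ennreal (L ^ n)"
    using emeasure_cube[of l q] emeasure_cube[of L x] \<open>0 < l\<close> \<open>0 < L\<close> by (simp_all add: Q_def R_def n_def)
  define S where "S y w = (\<integral>\<^sup>+s\<in>{0<..<1}. G (y + s *\<^sub>R (w - y)) *
      indicator {\<rho> (y + s *\<^sub>R (w - y))..} (s * L + l) \<partial>lborel)" for y w
  have "x \<in> R" using \<open>0 < L\<close> by (auto simp: R_def cube_def mem_box_cart)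
  have pt: "ennreal \<bar>f y\<bar> \<le> ennreal (2 * sqrt n * L) * S y w + ennreal \<bar>f w\<bar>" if "y \<in> Q" "w \<in> R" for y w
  proof -
    have yx: "norm (y - x) \<le> sqrt n * l" and wx: "norm (w - x) \<le> sqrt n * L"
      using that x \<open>x \<in> R\<close> norm_diff_cube_le by (auto simp: Q_def R_def n_def)
    have "norm (w - y) \<le> norm (w - x) + norm (y - x)"
      using norm_triangle_ineq4[of "w - x" "y - x"] by simp
    also have "\<dots> \<le> 2 * sqrt n * L"
      using yx wx mult_left_mono[OF \<open>l \<le> L\<close>, of "sqrt n"] by simp
    finally have wy: "norm (w - y) \<le> 2 * sqrt n * L" .
    have \<rho>: "\<rho> (y + s *\<^sub>R (w - y)) \<le> s * L + l" if "0 < s" "s < 1" for s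
    proof -
      have "norm (x - (y + s *\<^sub>R (w - y))) = norm ((1 - s) *\<^sub>R (y - x) + s *\<^sub>R (w - x))"
        by (subst norm_minus_commute) (simp add: algebra_simps)
      also have "\<dots> \<le> (1 - s) * norm (y - x) + s * norm (w - x)"
        using that norm_triangle_ineq[of "(1 - s) *\<^sub>R (y - x)" "s *\<^sub>R (w - x)"] by simp
      also have "\<dots> \<le> 1 * (sqrt n * l) + s * (sqrt n * L)"
        using that yx wx \<open>0 < l\<close> by (intro add_mono mult_mono) auto
      finally show ?thesis using \<open>0 < sqrt n\<close> by (simp add: \<rho>_def divide_le_eq algebra_simps)
    qed
    have "ennreal \<bar>f y\<bar> \<le> ennreal (\<bar>f w - f y\<bar> + \<bar>f w\<bar>)" by (intro ennreal_leI) linarith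
    also have "\<dots> = ennreal \<bar>f w - f y\<bar> + ennreal \<bar>f w\<bar>" by simp
    also have "ennreal \<bar>f w - f y\<bar> \<le> ennreal (norm (w - y)) * (\<integral>\<^sup>+s\<in>{0<..<1}. G (y + s *\<^sub>R (w - y)) \<partial>lborel)"
      unfolding G_def by (rule abs_diff_le_nn_integral_segment[OF der cont])
    also have "(\<integral>\<^sup>+s\<in>{0<..<1}. G (y + s *\<^sub>R (w - y)) \<partial>lborel) = S y w"
      unfolding S_def using \<rho> by (intro nn_integral_cong) (auto split: split_indicator)
    also have "ennreal (norm (w - y)) * S y w \<le> ennreal (2 * sqrt n * L) * S y w"
      using wy by (intro mult_right_mono ennreal_leI) auto
    finally show ?thesis by (simp add: add_right_mono)
  qed
  have meas: "(\<lambda>(y, w). S y w) \<in> borel_measurable (borel \<Otimes>\<^sub>M borel)"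
  proof -
    have "S y w = (\<integral>\<^sup>+s. (if 0 < s \<and> s < 1 \<and> \<rho> (y + s *\<^sub>R (w - y)) \<le> s * L + l
        then G (y + s *\<^sub>R (w - y)) else 0) \<partial>lborel)" for y w
      unfolding S_def by (intro nn_integral_cong) auto
    then show ?thesis by simp
  qed
  note [measurable] = meas
  have "ennreal (L ^ n) * (\<integral>\<^sup>+y\<in>Q. ennreal \<bar>f y\<bar> \<partial>lborel) = (\<integral>\<^sup>+y\<in>Q. (\<integral>\<^sup>+w\<in>R. ennreal \<bar>f y\<bar> \<partial>lborel) \<partial>lborel)"
    by (subst nn_integral_cmult[symmetric])
       (simp_all add: nn_integral_cmult_indicator R mult.assoc mult.left_commute[of "ennreal (L ^ n)"])
  also have "\<dots> \<le> (\<integral>\<^sup>+y\<in>Q. (\<integral>\<^sup>+w\<in>R. ennreal (2 * sqrt n * L) * S y w + ennreal \<bar>f w\<bar> \<partial>lborel) \<partial>lborel)"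
    using pt by (auto intro!: nn_integral_mono split: split_indicator)
  also have "\<dots> = (\<integral>\<^sup>+y. (ennreal (2 * sqrt n * L) * (\<integral>\<^sup>+w\<in>R. S y w \<partial>lborel)
      + (\<integral>\<^sup>+w\<in>R. ennreal \<bar>f w\<bar> \<partial>lborel)) * indicator Q y \<partial>lborel)"
    by (simp add: distrib_right nn_integral_add nn_integral_cmult mult.assoc)
  also have "\<dots> = ennreal (2 * sqrt n * L) * (\<integral>\<^sup>+y\<in>Q. (\<integral>\<^sup>+w\<in>R. S y w \<partial>lborel) \<partial>lborel)
      + (\<integral>\<^sup>+w\<in>R. ennreal \<bar>f w\<bar> \<partial>lborel) * ennreal (l ^ n)"
    by (simp add: distrib_right nn_integral_add nn_integral_cmult nn_integral_cmult_indicator Q mult.assoc)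
  also have "(\<integral>\<^sup>+y\<in>Q. (\<integral>\<^sup>+w\<in>R. S y w \<partial>lborel) \<partial>lborel)
      \<le> ennreal ((4 * l * L) ^ n / L) * (\<integral>\<^sup>+z. G z / ennreal (\<rho> z ^ (n - 1)) \<partial>lborel)"
    using nn_integral_segments_le[of G \<rho> Q R l L] n \<open>0 < l\<close> \<open>l \<le> L\<close> Q R \<open>0 < sqrt n\<close>
    by (simp add: S_def n_def \<rho>_def)
  also have "(\<integral>\<^sup>+z. G z / ennreal (\<rho> z ^ (n - 1)) \<partial>lborel) = ennreal (sqrt n ^ (n - 1)) * riesz_potential_1 G x"
    using \<open>0 < sqrt n\<close>
    by (simp add: \<rho>_def power_divide divide_ennreal_divide riesz_potential_1_def nn_integral_cmult flip: n_def)
  also have "(\<integral>\<^sup>+w\<in>R. ennreal \<bar>f w\<bar> \<partial>lborel) \<le> J"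
    unfolding J_def by (intro nn_integral_mono) (auto split: split_indicator)
  finally have main: "ennreal (L ^ n) * (\<integral>\<^sup>+y\<in>Q. ennreal \<bar>f y\<bar> \<partial>lborel) \<le>
     ennreal (2 * sqrt n * L) * (ennreal ((4 * l * L) ^ n / L) * (ennreal (sqrt n ^ (n - 1)) * riesz_potential_1 G x))
      + J * ennreal (l ^ n)"
    by (simp add: add_mono mult_left_mono mult_right_mono)
  \<comment> \<open>Normalization of the double integral over the two cubes to an average.\<close>
  define c where "c = ennreal (1 / (l ^ n * L ^ n))"
  have "c * (ennreal (L ^ n) * (\<integral>\<^sup>+y\<in>Q. ennreal \<bar>f y\<bar> \<partial>lborel)) \<le>
    c * (ennreal (2 * sqrt n * L) * (ennreal ((4 * l * L) ^ n / L) * (ennreal (sqrt n ^ (n - 1)) * riesz_potential_1 G x)))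
      + c * (J * ennreal (l ^ n))"
    using mult_left_mono[OF main, of c] by (simp add: distrib_left)
  moreover have "c * (ennreal (L ^ n) * (\<integral>\<^sup>+y\<in>Q. ennreal \<bar>f y\<bar> \<partial>lborel)) = cube_average f Q"
    using \<open>0 < l\<close> \<open>0 < L\<close>
    by (simp add: c_def cube_average_def Q mult.assoc[symmetric] ennreal_mult[symmetric] divide_ennreal_def inverse_ennreal
        inverse_eq_divide mult.commute)
  moreover have "c * (J * ennreal (l ^ n)) = ennreal (1 / L ^ n) * J"
  proof -
    have "c * (J * ennreal (l ^ n)) = c * ennreal (l ^ n) * J" by (simp add: mult_ac)
    also have "c * ennreal (l ^ n) = ennreal (1 / L ^ n)"
      using \<open>0 < l\<close> \<open>0 < L\<close> by (simp add: c_def flip: ennreal_mult)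
    finally show ?thesis .
  qed
  moreover have "c * (ennreal (2 * sqrt n * L) * (ennreal ((4 * l * L) ^ n / L) * (ennreal (sqrt n ^ (n - 1)) * riesz_potential_1 G x)))
     = ennreal (2 * sqrt n * 4 ^ n * sqrt n ^ (n - 1)) * riesz_potential_1 G x"
  proof -
    have prod: "ennreal X * ennreal Y * ennreal Z * ennreal W = ennreal (X * Y * Z * W)"
      if "0 \<le> X" "0 \<le> Y" "0 \<le> Z" "0 \<le> W" for X Y Z W
      using that by (simp add: ennreal_mult)
    have "c * ennreal (2 * sqrt n * L) * ennreal ((4 * l * L) ^ n / L) * ennreal (sqrt n ^ (n - 1))
      = ennreal (1 / (l ^ n * L ^ n) * (2 * sqrt n * L) * ((4 * l * L) ^ n / L) * sqrt n ^ (n - 1))"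
      unfolding c_def using \<open>0 < l\<close> \<open>0 < L\<close>
      by (intro prod) auto
    also have "1 / (l ^ n * L ^ n) * (2 * sqrt n * L) * ((4 * l * L) ^ n / L) * sqrt n ^ (n - 1)
      = 2 * sqrt n * 4 ^ n * sqrt n ^ (n - 1)"
      using \<open>0 < l\<close> \<open>0 < L\<close> by (simp add: power_mult_distrib)
    finally have eq: "c * ennreal (2 * sqrt n * L) * ennreal ((4 * l * L) ^ n / L) * ennreal (sqrt n ^ (n - 1))
      = ennreal (2 * sqrt n * 4 ^ n * sqrt n ^ (n - 1))" .
    show ?thesis by (simp only: eq flip: mult.assoc)
  qed
  ultimately show ?thesis by (simp add: Q_def n_def G_def[abs_def] J_def)
qed

text \<open>
  The remainder in the preceding estimate tends to \<open>0\<close> as \<open>L\<close> grows, because \<open>f\<close> is integrable.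
\<close>

lemma HL_maximal_le_riesz:
  fixes f :: "real^'n::finite \<Rightarrow> real" and x :: "real^'n"
  assumes n: "2 \<le> CARD('n)"
    and der: "\<And>x. (f has_derivative (\<lambda>h. h \<bullet> D x)) (at x)" and cont: "continuous_on UNIV D"
    and fin: "(\<integral>\<^sup>+w. ennreal \<bar>f w\<bar> \<partial>lborel) < \<infinity>"
  shows "HL_maximal f x \<le> ennreal (2 * sqrt CARD('n) * 4 ^ CARD('n) * sqrt CARD('n) ^ (CARD('n) - 1)) *
      riesz_potential_1 (\<lambda>z. ennreal (norm (D z))) x" (is "_ \<le> ?R")
  unfolding HL_maximal_def
proof (rule SUP_least, clarify)
  fix q :: "real^'n" and l assume "(q, l) \<in> cubes_at x"
  then have l: "0 < l" and x: "x \<in> cube q l" by (auto simp: cubes_at_def)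
  obtain J where J: "(\<integral>\<^sup>+w. ennreal \<bar>f w\<bar> \<partial>lborel) = ennreal J" "0 \<le> J"
    using fin by (cases "\<integral>\<^sup>+w. ennreal \<bar>f w\<bar> \<partial>lborel") auto
  show "cube_average f (cube q l) \<le> ?R"
  proof (rule ennreal_le_epsilon)
    fix \<epsilon> :: real assume "0 < \<epsilon>"
    \<comment> \<open>The maximum with 1 gives \<open>L \<le> L\<^sup>n\<close>, so that \<open>L\<close> only has to exceed \<open>J / \<epsilon>\<close>.\<close>
    define L where "L = max l (max 1 (J / \<epsilon>))"
    have L: "l \<le> L" "1 \<le> L" "J / \<epsilon> \<le> L" by (auto simp: L_def)
    have "J / \<epsilon> \<le> L ^ CARD('n)"
      using L power_increasing[of 1 "CARD('n)" L] by (simp add: order_trans)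
    then have "1 / L ^ CARD('n) * J \<le> \<epsilon>"
      using \<open>0 < \<epsilon>\<close> L by (simp add: divide_simps mult.commute)
    then have "ennreal (1 / L ^ CARD('n)) * (\<integral>\<^sup>+w. ennreal \<bar>f w\<bar> \<partial>lborel) \<le> ennreal \<epsilon>"
      using J L by (simp add: ennreal_leI flip: ennreal_mult)
    then show "cube_average f (cube q l) \<le> ?R + ennreal \<epsilon>"
      using cube_average_le_riesz_add[OF n x l L(1) der cont] by (rule order_trans[OF _ add_left_mono, rotated])
  qed
qed

section \<open>Smooth functions with compact support\<close>

text \<open>
  The definite description in the definition of the gradient is justified: the adjoint of the
  Frechet derivative provides a gradient, and an inner product determines its right argument.
\<close>

lemma Cc_infinity_has_derivative:
  fixes f :: "real^'n::finite \<Rightarrow> real"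
  assumes "f \<in> Cc_infinity"
  shows "(f has_derivative (\<lambda>h. h \<bullet> gradient f x)) (at x)"
proof -
  have "C_k 1 f" using assms by (simp add: Cc_infinity_def)
  then obtain L where L: "(f has_derivative L) (at x)"
    by (auto simp: differentiable_def)
  have "L = (\<lambda>h. h \<bullet> adjoint L 1)"
    using adjoint_works[OF has_derivative_linear[OF L]] by auto
  then have "(f has_derivative (\<lambda>h. h \<bullet> adjoint L 1)) (at x)"
    using L by metis
  then have ex: "\<exists>D. GDERIV f x :> D" unfolding gderiv_def by blast
  have "D = D'" if "GDERIV f x :> D" "GDERIV f x :> D'" for D D'
    using has_derivative_unique[OF that[unfolded gderiv_def]]
    by (metis vector_eq_ldot)
  with ex have "GDERIV f x :> gradient f x"
    unfolding gradient_def by (metis (mono_tags) theI')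
  then show ?thesis by (simp add: gderiv_def)
qed

lemma Cc_infinity_continuous_gradient:
  fixes f :: "real^'n::finite \<Rightarrow> real"
  assumes "f \<in> Cc_infinity"
  shows "continuous_on UNIV (gradient f)"
proof -
  have "frechet_derivative f (at x) (axis i 1) = gradient f x $ i" for x i
    using frechet_derivative_at[OF Cc_infinity_has_derivative[OF assms]]
    by (metis inner_axis' inner_real_def mult_1)
  moreover have "C_k (Suc 0) f" using assms by (simp add: Cc_infinity_def)
  ultimately have "continuous_on UNIV (\<lambda>x. gradient f x $ i)" for i by simp
  then have "continuous_on UNIV (\<lambda>x. \<chi> i. gradient f x $ i)"
    by (rule continuous_on_vec_lambda)
  then show ?thesis by simp
qed

lemma Cc_infinity_continuous:
  fixes f :: "real^'n::finite \<Rightarrow> real"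
  assumes "f \<in> Cc_infinity"
  shows "continuous_on UNIV f"
  using assms by (simp add: Cc_infinity_def) (metis C_k.simps(1))

lemma Cc_infinity_nn_integral_finite:
  fixes f :: "real^'n::finite \<Rightarrow> real"
  assumes "f \<in> Cc_infinity"
  shows "(\<integral>\<^sup>+y. ennreal \<bar>f y\<bar> \<partial>lborel) < \<infinity>"
proof -
  define K where "K = closure {x. f x \<noteq> 0}"
  have "compact K" using assms by (simp add: Cc_infinity_def K_def)
  then have "set_integrable lborel K f"
    unfolding set_integrable_def
    by (intro borel_integrable_compact continuous_on_subset[OF Cc_infinity_continuous[OF assms]]) auto
  moreover have "(\<lambda>x. indicator K x *\<^sub>R f x) = f"
    using closure_subset[of "{x. f x \<noteq> 0}"] by (auto simp: K_def fun_eq_iff indicator_def)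
  ultimately have "integrable lborel f" by (simp only: set_integrable_def)
  then show ?thesis by (simp add: integrable_iff_bounded)
qed

theorem theorem1p1:
  assumes "CARD('n::finite) \<ge> 2"
  shows "(\<exists>C>0. \<forall>f \<in> (Cc_infinity :: (real^'n \<Rightarrow> real) set). \<forall>x.
            lorentz_maximal (dual_exponent CARD('n)) 1 f x
              \<le> ennreal C * fractional_maximal_1 (\<lambda>y. norm (gradient f y)) x
                + ennreal (dual_exponent CARD('n)) * HL_maximal f x) \<and>
         (\<exists>C>0. \<forall>f \<in> (Cc_infinity :: (real^'n \<Rightarrow> real) set). \<forall>x.
            lorentz_maximal (dual_exponent CARD('n)) 1 f x
              \<le> ennreal C * riesz_potential_1 (\<lambda>y. ennreal (norm (gradient f y))) x)"
proof -
  let ?n = "CARD('n)"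
  define p where "p = dual_exponent ?n"
  define C\<^sub>1 where "C\<^sub>1 = p * (2 * sqrt ?n * 4 ^ ?n)"
  define C\<^sub>2 where "C\<^sub>2 = sqrt ?n ^ (?n - 1)"
  define C\<^sub>3 where "C\<^sub>3 = 2 * sqrt ?n * 4 ^ ?n * sqrt ?n ^ (?n - 1)"
  have pos: "0 < p" "0 < C\<^sub>1" "0 < C\<^sub>2" "0 < C\<^sub>3"
    using assms by (auto simp: p_def C\<^sub>1_def C\<^sub>2_def C\<^sub>3_def dual_exponent_def)
  have first: "lorentz_maximal p 1 f x
      \<le> ennreal C\<^sub>1 * fractional_maximal_1 (\<lambda>y. norm (gradient f y)) x + ennreal p * HL_maximal f x"
    if f: "f \<in> Cc_infinity" for f :: "real^'n \<Rightarrow> real" and x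
    unfolding lorentz_maximal_def
  proof (rule SUP_least, clarify)
    fix a :: "real^'n" and l assume al: "(a, l) \<in> cubes_at x"
    then have "0 < l" by (simp add: cubes_at_def)
    have "lorentz_norm p 1 (uniform_measure lborel (cube a l)) f
        \<le> ennreal C\<^sub>1 * (ennreal l * cube_average (\<lambda>y. norm (gradient f y)) (cube a l))
          + ennreal p * cube_average f (cube a l)"
      unfolding p_def C\<^sub>1_def
      by (rule lorentz_norm_cube_le[OF assms \<open>0 < l\<close> Cc_infinity_has_derivative[OF f]
            Cc_infinity_continuous_gradient[OF f]])
    also have "\<dots> \<le> ennreal C\<^sub>1 * fractional_maximal_1 (\<lambda>y. norm (gradient f y)) x + ennreal p * HL_maximal f x"
      unfolding fractional_maximal_1_def HL_maximal_def
      by (intro add_mono mult_left_mono SUP_upper2[OF al]) auto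
    finally show "lorentz_norm p 1 (uniform_measure lborel (cube a l)) f
        \<le> ennreal C\<^sub>1 * fractional_maximal_1 (\<lambda>y. norm (gradient f y)) x + ennreal p * HL_maximal f x" .
  qed
  moreover have "lorentz_maximal p 1 f x
      \<le> ennreal (C\<^sub>1 * C\<^sub>2 + p * C\<^sub>3) * riesz_potential_1 (\<lambda>y. ennreal (norm (gradient f y))) x"
    if f: "f \<in> Cc_infinity" for f :: "real^'n \<Rightarrow> real" and x
  proof -
    let ?I = "riesz_potential_1 (\<lambda>y. ennreal (norm (gradient f y))) x"
    have [measurable]: "gradient f \<in> borel_measurable borel"
      by (rule borel_measurable_continuous_onI[OF Cc_infinity_continuous_gradient[OF f]])
    have "fractional_maximal_1 (\<lambda>y. norm (gradient f y)) x \<le> ennreal C\<^sub>2 * ?I"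
      using fractional_maximal_1_le_riesz[OF assms, of "\<lambda>y. norm (gradient f y)" x] by (simp add: C\<^sub>2_def)
    moreover have "HL_maximal f x \<le> ennreal C\<^sub>3 * ?I"
      unfolding C\<^sub>3_def
      by (rule HL_maximal_le_riesz[OF assms Cc_infinity_has_derivative[OF f]
            Cc_infinity_continuous_gradient[OF f] Cc_infinity_nn_integral_finite[OF f]])
    ultimately have "lorentz_maximal p 1 f x \<le> ennreal C\<^sub>1 * (ennreal C\<^sub>2 * ?I) + ennreal p * (ennreal C\<^sub>3 * ?I)"
      using first[OF f, of x] by (auto elim!: order_trans intro!: add_mono mult_left_mono)
    also have "\<dots> = ennreal (C\<^sub>1 * C\<^sub>2 + p * C\<^sub>3) * ?I"
      using pos by (simp add: distrib_right ennreal_mult mult.assoc)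
    finally show ?thesis .
  qed
  moreover have "0 < C\<^sub>1 * C\<^sub>2 + p * C\<^sub>3" using pos by (simp add: add_pos_pos)
  ultimately show ?thesis using pos unfolding p_def by blast
qed

end
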